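(* Let $d,m\in\mathbb{N}$, $p\in[1,d)$, $r>0$, and $p^*:=\frac{pd}{d-p}$. Then there exists a constant $C=C(p,d,r)>0$ such that for every $\varepsilon>0$ and every $u\in L^p(\mathbb{R}^d;\mathbb{R}^m)$ $$\left(\int_{\mathbb{R}^d}|T_\varepsilon u(x)|^{p^*}\,dx\right)^{\frac{p}{p^*}}\le C\,G^{r,p}_\varepsilon(u,\mathbb{R}^d).$$
   Context: For $r,\varepsilon>0$, $p\ge1$, $$G^{r,p}_\varepsilon(u,\mathbb{R}^d):=\int_{B_r}\int_{\mathbb{R}^d}\left|\frac{u(x+\varepsilon\xi)-u(x)}{\varepsilon}\right|^p\,dx\,d\xi,$$ where $B_r$ is the open ball of $\mathbb{R}^d$ centred at $0$ with radius $r$. Set $\tilde r:=\frac{r}{\sqrt{d+3}}$. For $u\in L^p(\mathbb{R}^d;\mathbb{R}^m)$, $T_\varepsilon u$ is the function that is constant on each cube $\tilde r\varepsilon k+[0,\tilde r\varepsilon)^d$, $k\in\mathbb{Z}^d$, with value there equal to the average of $u$: $$T_\varepsilon u(x):=\frac{1}{(\tilde r\varepsilon)^d}\int_{\tilde r\varepsilon k+[0,\tilde r\varepsilon)^d}u(y)\,dy\quad\text{for }x\in\tilde r\varepsilon k+[0,\tilde r\varepsilon)^d,\ k\in\mathbb{Z}^d.$$ *)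

theory Defs
  imports "HOL-Analysis.Analysis"
begin

text \<open>
  The domain is \<open>real ^ 'd\<close>.  Vectors of the target space \<open>\<real>\<^sup>m\<close> are represented by their
  coordinate functions \<open>nat \<Rightarrow> real\<close> restricted to \<open>{..<m}\<close>, with Euclidean norm
  \<open>L2_set v {..<m}\<close>.  Thus \<open>m\<close> is an ordinary number that can be quantified inside a formula,
  which is needed to express that a constant does not depend on \<open>m\<close>.
\<close>

definition in_Lp :: "real \<Rightarrow> nat \<Rightarrow> (real ^ 'd \<Rightarrow> nat \<Rightarrow> real) \<Rightarrow> bool" where
  "in_Lp p m u \<longleftrightarrow>
     (\<forall>i<m. (\<lambda>x. u x i) \<in> borel_measurable lebesgue) \<and>
     (\<integral>\<^sup>+x. ennreal (L2_set (u x) {..<m} powr p) \<partial>lebesgue) < \<infinity>"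

text \<open>Power of an extended nonnegative number, for exponents \<open>a > 0\<close>.\<close>

definition ennreal_powr :: "ennreal \<Rightarrow> real \<Rightarrow> ennreal" where
  "ennreal_powr x a = (if x = \<infinity> then \<infinity> else ennreal (enn2real x powr a))"

definition G_energy ::
    "real \<Rightarrow> real \<Rightarrow> real \<Rightarrow> nat \<Rightarrow> (real ^ 'd \<Rightarrow> nat \<Rightarrow> real) \<Rightarrow> ennreal" where
  "G_energy r p \<epsilon> m u =
     (\<integral>\<^sup>+\<xi>\<in>ball 0 r.
        (\<integral>\<^sup>+x. ennreal (L2_set (\<lambda>i. (u (x + \<epsilon> *\<^sub>R \<xi>) i - u x i) / \<epsilon>) {..<m} powr p) \<partial>lebesgue)
      \<partial>lebesgue)"

definition cube :: "real \<Rightarrow> int ^ 'd \<Rightarrow> (real ^ 'd) set" where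
  "cube s k = {x. \<forall>j. s * of_int (k $ j) \<le> x $ j \<and> x $ j < s * of_int (k $ j) + s}"

definition cube_index :: "real \<Rightarrow> real ^ 'd \<Rightarrow> int ^ 'd" where
  "cube_index s x = (\<chi> j. \<lfloor>x $ j / s\<rfloor>)"

lemma mem_cube_iff:
  assumes "s > 0"
  shows "x \<in> cube s k \<longleftrightarrow> k = cube_index s x"
proof -
  have "s * of_int n \<le> t \<and> t < s * of_int n + s \<longleftrightarrow> n = \<lfloor>t / s\<rfloor>" for t :: real and n :: int
  proof -
    have "s * of_int n \<le> t \<and> t < s * of_int n + s \<longleftrightarrow> of_int n \<le> t / s \<and> t / s < of_int n + 1"
      using assms by (simp add: field_simps)
    also have "\<dots> \<longleftrightarrow> n = \<lfloor>t / s\<rfloor>"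
      by (auto simp: eq_commute[of n] floor_eq_iff)
    finally show ?thesis .
  qed
  then show ?thesis
    by (simp add: cube_def cube_index_def vec_eq_iff)
qed

definition r_tilde :: "'d::finite itself \<Rightarrow> real \<Rightarrow> real" where
  "r_tilde _ r = r / sqrt (real CARD('d) + 3)"

text \<open>Piecewise constant interpolation, taken coordinatewise; by lemma \<open>mem_cube_iff\<close> the index used
  at \<open>x\<close> is the unique \<open>k\<close> with \<open>x\<close> in the cube of index \<open>k\<close>.\<close>

definition T_avg ::
    "real \<Rightarrow> real \<Rightarrow> (real ^ 'd \<Rightarrow> nat \<Rightarrow> real) \<Rightarrow> real ^ 'd \<Rightarrow> nat \<Rightarrow> real" where
  "T_avg r \<epsilon> u x i =
     (let s = r_tilde TYPE('d) r * \<epsilon>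
      in 1 / s ^ CARD('d) * (LINT y:cube s (cube_index s x)|lebesgue. u y i))"

end

theory Submission
  imports Defs
begin

text \<open>
  Taking Euclidean norms decreases differences, and the norm of an average is at most the average of the norms, so
  one may replace \<open>u\<close> by the scalar function \<open>U = |u|\<close>; in particular the constant does not depend on \<open>m\<close>.
  The means \<open>w\<close> of \<open>U\<close> over the cubes form a function on \<open>\<int>\<^sup>d\<close>, for which the discrete Sobolev inequality bounds
  the \<open>p\<^sup>*\<close>-norm by the \<open>p\<close>-norms of the differences of neighbours.  As in the continuous case it
  follows from the case \<open>p = 1\<close> (Loomis--Whitney) applied to a power of \<open>w\<close>.  Finally, two points of adjacent cubes
  of side \<open>r \<epsilon> / sqrt (d + 3)\<close> are less than \<open>r \<epsilon>\<close> apart, so by Jensen's inequality the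
  differences of neighbouring means are controlled by the nonlocal energy.
\<close>

section \<open>The Sobolev inequality on the integer lattice\<close>

text \<open>Scaling every \<open>F j\<close> to total 1 reduces this Hoelder inequality for several
  factors to the arithmetic-geometric mean inequality, summed over \<open>t\<close>.\<close>

lemma sum_prod_powr_le:
  fixes F :: "'j \<Rightarrow> 't \<Rightarrow> real"
  assumes "finite T" and J: "finite J" "J \<noteq> {}"
    and nonneg: "\<And>j t. j \<in> J \<Longrightarrow> t \<in> T \<Longrightarrow> 0 \<le> F j t"
    and a: "a = 1 / real (card J)"
  shows "(\<Sum>t\<in>T. \<Prod>j\<in>J. F j t powr a) \<le> (\<Prod>j\<in>J. (\<Sum>t\<in>T. F j t) powr a)"
proof -
  define S where "S j = (\<Sum>t\<in>T. F j t)" for j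
  have S0: "0 \<le> S j" if "j \<in> J" for j
    unfolding S_def using nonneg that by (intro sum_nonneg) auto
  show ?thesis
  proof (cases "\<exists>j\<in>J. S j = 0")
    \<comment> \<open>A vanishing total cannot be scaled to 1, but then \<open>F j\<close> is zero
      on \<open>T\<close> and, since \<open>0 powr a = 0\<close>, so is every product.\<close>
    case True
    then obtain j where j: "j \<in> J" "S j = 0" by blast
    then have "F j t = 0" if "t \<in> T" for t
      using sum_nonneg_eq_0_iff[OF \<open>finite T\<close>, of "F j"] nonneg that unfolding S_def by blast
    then have "(\<Sum>t\<in>T. \<Prod>j\<in>J. F j t powr a) = 0"
      using j J by (intro sum.neutral ballI prod_zero) auto
    then show ?thesis by (simp add: prod_nonneg)
  next
    case False
    with S0 have Spos: "0 < S j" if "j \<in> J" for j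
      using that by fastforce
    have amgm: "(\<Prod>j\<in>J. F j t powr a) \<le> (\<Prod>j\<in>J. S j powr a) * (\<Sum>j\<in>J. a * (F j t / S j))"
      if t: "t \<in> T" for t
    proof -
      have "(\<Prod>j\<in>J. F j t powr a) = (\<Prod>j\<in>J. S j powr a * (F j t / S j) powr a)"
      proof (rule prod.cong[OF refl])
        fix j assume "j \<in> J"
        then show "F j t powr a = S j powr a * (F j t / S j) powr a"
          using Spos[of j] nonneg[of j t] t by (simp flip: powr_mult)
      qed
      also have "\<dots> = (\<Prod>j\<in>J. S j powr a) * (\<Prod>j\<in>J. F j t / S j) powr a"
        using Spos nonneg t by (simp add: prod.distrib prod_powr_distrib less_imp_le)
      also have "\<dots> \<le> (\<Prod>j\<in>J. S j powr a) * (\<Sum>j\<in>J. F j t / S j / card J)"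
        unfolding a using Spos nonneg t J
        by (intro mult_left_mono arith_geom_mean prod_nonneg) (auto simp: less_imp_le)
      finally show ?thesis by (simp add: a mult.commute)
    qed
    have "(\<Sum>t\<in>T. \<Prod>j\<in>J. F j t powr a)
        \<le> (\<Sum>t\<in>T. (\<Prod>j\<in>J. S j powr a) * (\<Sum>j\<in>J. a * (F j t / S j)))"
      by (intro sum_mono amgm)
    also have "\<dots> = (\<Prod>j\<in>J. S j powr a) * (\<Sum>j\<in>J. \<Sum>t\<in>T. a * (F j t / S j))"
      by (subst sum.swap) (simp add: sum_distrib_left)
    also have "(\<Sum>j\<in>J. \<Sum>t\<in>T. a * (F j t / S j)) = (\<Sum>j\<in>J. a)"
    proof (rule sum.cong[OF refl])
      fix j assume "j \<in> J"
      then show "(\<Sum>t\<in>T. a * (F j t / S j)) = a"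
        using Spos[of j] by (simp add: S_def flip: sum_distrib_left sum_divide_distrib)
    qed
    also have "(\<Sum>j\<in>J. a) = 1" using J a by (simp add: card_gt_0_iff)
    finally show ?thesis by (simp add: S_def)
  qed
qed

lemma sum_PiE_insert:
  assumes "i \<notin> K"
  shows "sum f (PiE (insert i K) A) = (\<Sum>x\<in>PiE K A. \<Sum>t\<in>A i. f (x(i := t)))"
proof -
  have "sum f (PiE (insert i K) A) = sum (f \<circ> (\<lambda>(t, x). x(i := t))) (A i \<times> PiE K A)"
    unfolding PiE_insert_eq using assms
    by (intro sum.reindex) (auto intro!: inj_combinator)
  also have "\<dots> = (\<Sum>t\<in>A i. \<Sum>x\<in>PiE K A. f (x(i := t)))"
    by (simp add: sum.cartesian_product case_prod_beta)
  finally show ?thesis by (subst sum.swap)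
qed

text \<open>The \<open>j\<close>-th function does not depend on coordinate \<open>j\<close>.  Summing out one further coordinate \<open>i\<close> by
  Hoelder's inequality affects only the other functions, and replaces them by their marginals, which satisfy the same
  hypotheses; this is why the claim is stated for a subset \<open>K\<close> of the coordinates.\<close>

lemma loomis_whitney:
  fixes f :: "'i::finite \<Rightarrow> ('i \<Rightarrow> 'b) \<Rightarrow> real"
  assumes "finite K" and A: "\<And>i. finite (A i)"
    and card: "2 \<le> CARD('i)" and a: "a = 1 / real (CARD('i) - 1)"
    and "\<And>j x. 0 \<le> f j x"
    and "\<And>j x t. f j (x(j := t)) = f j x"
  shows "(\<Sum>x\<in>PiE K A. \<Prod>j\<in>UNIV. f j x powr a) \<le> (\<Prod>j\<in>UNIV. (\<Sum>x\<in>PiE (K - {j}) A. f j x) powr a)"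
  using assms(1,5,6)
proof (induction K arbitrary: f rule: finite_induct)
  \<comment> \<open>\<open>PiE {} A\<close> is a singleton, so both sides reduce to the same
    product.\<close>
  case empty
  then show ?case by simp
next
  case (insert i K)
  define g where "g j x = (if j = i then f j x else (\<Sum>t\<in>A i. f j (x(i := t))))" for j x
  have split: "(\<Prod>j\<in>UNIV. h j) = h i * (\<Prod>j\<in>UNIV - {i}. h j)" for h :: "'i \<Rightarrow> real"
    by (simp add: prod.remove)
  have "(\<Sum>x\<in>PiE (insert i K) A. \<Prod>j\<in>UNIV. f j x powr a)
      = (\<Sum>x\<in>PiE K A. f i x powr a * (\<Sum>t\<in>A i. \<Prod>j\<in>UNIV - {i}. f j (x(i := t)) powr a))"
    by (subst sum_PiE_insert[OF insert.hyps(2)])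
      (simp add: split insert.prems(2) sum_distrib_left)
  \<comment> \<open>Hoelder's inequality in coordinate \<open>i\<close>: the factor with index
    \<open>i\<close> has come out, and the number of remaining factors, \<open>CARD('i) - 1\<close>,
    is what fixes the exponent \<open>a\<close>.\<close>
  also have "\<dots> \<le> (\<Sum>x\<in>PiE K A. f i x powr a * (\<Prod>j\<in>UNIV - {i}. (\<Sum>t\<in>A i. f j (x(i := t))) powr a))"
  proof (intro sum_mono mult_left_mono sum_prod_powr_le)
    have "card (UNIV - {i}) \<noteq> 0" using card by (simp add: card_Diff_singleton)
    then show "UNIV - {i} \<noteq> {}" by force
    show "a = 1 / real (card (UNIV - {i}))" using a by (simp add: card_Diff_singleton)
  qed (use A insert.prems(1) in auto)
  also have "\<dots> = (\<Sum>x\<in>PiE K A. \<Prod>j\<in>UNIV. g j x powr a)"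
    by (simp add: split g_def)
  also have "\<dots> \<le> (\<Prod>j\<in>UNIV. (\<Sum>x\<in>PiE (K - {j}) A. g j x) powr a)"
  proof (rule insert.IH)
    show "0 \<le> g j x" for j x using insert.prems(1) by (simp add: g_def sum_nonneg)
    show "g j (x(j := t)) = g j x" for j x t
    proof (cases "j = i")
      case True
      then show ?thesis by (simp only: g_def insert.prems(2) simp_thms if_True)
    next
      case False
      then have "f j (x(j := t, i := s)) = f j (x(i := s))" for s
        using insert.prems(2)[of j "x(i := s)" t] fun_upd_twist[of j i x t s] by metis
      then show ?thesis using False by (simp add: g_def)
    qed
  qed
  also have "\<dots> = (\<Prod>j\<in>UNIV. (\<Sum>x\<in>PiE (insert i K - {j}) A. f j x) powr a)"
  proof (rule prod.cong[OF refl])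
    fix j
    show "(\<Sum>x\<in>PiE (K - {j}) A. g j x) powr a = (\<Sum>x\<in>PiE (insert i K - {j}) A. f j x) powr a"
    proof (cases "j = i")
      case False
      then have "insert i K - {j} = insert i (K - {j})" by auto
      then show ?thesis using False insert.hyps(2) by (simp add: g_def sum_PiE_insert)
    next
      case True
      then show ?thesis using insert.hyps(2) by (simp add: g_def)
    qed
  qed
  finally show ?case .
qed

section \<open>The lattice Sobolev inequality for \<open>p = 1\<close>\<close>

text \<open>A summable \<open>g\<close> tends to 0 along \<open>k\<close>, \<open>k + 1\<close>, and
  so on, so telescoping from \<open>k\<close> to infinity recovers \<open>g k\<close> from the
  increments.\<close>

lemma int_telescope_le:
  fixes g :: "int \<Rightarrow> real"
  assumes g0: "\<And>t. 0 \<le> g t" and g: "g summable_on UNIV"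
    and h: "(\<lambda>t. \<bar>g (t + 1) - g t\<bar>) summable_on UNIV"
  shows "g k \<le> (\<Sum>\<^sub>\<infinity>t. \<bar>g (t + 1) - g t\<bar>)"
proof -
  define D where "D = (\<Sum>\<^sub>\<infinity>t. \<bar>g (t + 1) - g t\<bar>)"
  have inj: "inj_on (\<lambda>n. k + int n) X" for X by (auto simp: inj_on_def)
  have step: "g k \<le> D + g (k + int n)" for n
  proof -
    have "g k \<le> (\<Sum>i<n. \<bar>g (k + int i + 1) - g (k + int i)\<bar>) + g (k + int n)"
    proof (induction n)
      case (Suc n)
      have "g (k + int (Suc n)) = g (k + int n + 1)" by (simp add: add_ac)
      then show ?case using Suc unfolding sum.lessThan_Suc by linarith
    qed simp
    also have "(\<Sum>i<n. \<bar>g (k + int i + 1) - g (k + int i)\<bar>)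
        = (\<Sum>t\<in>(\<lambda>n. k + int n) ` {..<n}. \<bar>g (t + 1) - g t\<bar>)"
      by (subst sum.reindex[OF inj]) simp
    also have "\<dots> \<le> D" unfolding D_def by (intro finite_sum_le_infsum h) auto
    finally show ?thesis by simp
  qed
  have "g summable_on range (\<lambda>n. k + int n)"
    using g by (rule summable_on_subset_banach) simp
  then have "(\<lambda>n. g (k + int n)) summable_on UNIV"
    using summable_on_reindex[OF inj] by (auto simp: o_def)
  then have "summable (\<lambda>n. g (k + int n))"
    by (rule summable_on_imp_summable)
  then have "(\<lambda>n. D + g (k + int n)) \<longlonglongrightarrow> D + 0"
    by (intro tendsto_intros summable_LIMSEQ_zero)
  then show ?thesis using step unfolding D_def
    by (intro LIMSEQ_le_const) auto
qed

text \<open>The box spanned by the coordinate projections; needed because the Loomis--Whitney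
  inequality is stated for boxes.\<close>

lemma finite_subset_PiE:
  fixes F :: "('i::finite \<Rightarrow> 'b) set"
  assumes "finite F"
  obtains A where "\<And>i. finite (A i)" "F \<subseteq> PiE UNIV A"
  using assms by (intro that[of "\<lambda>i. (\<lambda>x. x i) ` F"]) auto

text \<open>On every axis-parallel line \<open>g\<close> is bounded by its variation along that
  line. Multiplying these bounds over all directions, each to the power
  \<open>1 / (CARD('i) - 1)\<close>, gives a product to which the Loomis--Whitney inequality
  applies. Bounding the variation on finite sets by \<open>D\<close> also supplies its
  summability.\<close>

lemma gagliardo_nirenberg_discrete:
  fixes g :: "('i::finite \<Rightarrow> int) \<Rightarrow> real"
  assumes card: "2 \<le> CARD('i)" and g0: "\<And>k. 0 \<le> g k" and g: "g summable_on UNIV"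
    and D: "\<And>j F. finite F \<Longrightarrow> (\<Sum>k\<in>F. \<bar>g (k(j := k j + 1)) - g k\<bar>) \<le> D"
    and "finite F"
  shows "(\<Sum>k\<in>F. g k powr (real CARD('i) / real (CARD('i) - 1))) \<le> D powr (real CARD('i) / real (CARD('i) - 1))"
proof -
  define a where "a = 1 / real (CARD('i) - 1)"
  have a: "real CARD('i) / real (CARD('i) - 1) = real CARD('i) * a" "a > 0"
    using card by (simp_all add: a_def)
  define h where "h j k = \<bar>g (k(j := k j + 1)) - g k\<bar>" for j k
  \<comment> \<open>The variation of \<open>g\<close> along the line through \<open>x\<close> in
    direction \<open>j\<close>; it does not depend on \<open>x j\<close>, as the Loomis--Whitney
    inequality requires.\<close>
  define f where "f j x = infsum (h j) (range (\<lambda>t. x(j := t)))" for j x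
  have D0: "0 \<le> D" using D[of "{}"] by simp
  have inj: "inj_on (\<lambda>t. x(j := t)) X" for x :: "'i \<Rightarrow> int" and j X
    by (auto simp: inj_on_def dest: fun_upd_eqD)
  have h: "h j summable_on X" for j X
  proof (rule nonneg_bdd_above_summable_on)
    show "bdd_above (sum (h j) ` {F. F \<subseteq> X \<and> finite F})"
      using D unfolding h_def by (auto intro!: bdd_aboveI[of _ D])
  qed (simp add: h_def)
  have hD: "infsum (h j) X \<le> D" for j X
    using h D unfolding h_def by (intro infsum_le_finite_sums) auto
  have f0: "0 \<le> f j x" for j x
    unfolding f_def by (intro infsum_nonneg) (simp add: h_def)
  have gf: "g k \<le> f j k" for j k
  proof -
    have *: "h j (k(j := t)) = \<bar>g (k(j := t + 1)) - g (k(j := t))\<bar>" for t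
      by (simp add: h_def)
    have "g (k(j := k j)) \<le> (\<Sum>\<^sub>\<infinity>t. \<bar>g (k(j := t + 1)) - g (k(j := t))\<bar>)"
    proof (rule int_telescope_le)
      have "g summable_on range (\<lambda>t. k(j := t))"
        using g by (rule summable_on_subset_banach) simp
      then show "(\<lambda>t. g (k(j := t))) summable_on UNIV"
        using summable_on_reindex[OF inj] by (auto simp: o_def)
      show "(\<lambda>t. \<bar>g (k(j := t + 1)) - g (k(j := t))\<bar>) summable_on UNIV"
        using h summable_on_reindex[OF inj[of k j UNIV], of "h j"] by (simp add: o_def *)
    qed (rule g0)
    also have "\<dots> = f j k"
      unfolding f_def by (subst infsum_reindex[OF inj]) (simp add: o_def *)
    finally show ?thesis by simp
  qed
  have fD: "(\<Sum>x\<in>PiE (UNIV - {j}) A. f j x) \<le> D" if "\<And>i. finite (A i)" for j and A :: "'i \<Rightarrow> int set"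
  proof -
    have "(\<Sum>x\<in>PiE (UNIV - {j}) A. f j x)
        = infsum (h j) (\<Union>x\<in>PiE (UNIV - {j}) A. range (\<lambda>t. x(j := t)))"
      unfolding f_def
    proof (rule sum_infsum)
      show "finite (PiE (UNIV - {j}) A)" using that by (intro finite_PiE) auto
    next
      fix x y assume xy: "x \<in> PiE (UNIV - {j}) A" "y \<in> PiE (UNIV - {j}) A" "x \<noteq> y"
      \<comment> \<open>Base points are \<open>undefined\<close> at \<open>j\<close>, so two
        different ones differ in another coordinate and their lines in direction \<open>j\<close>
        are disjoint.\<close>
      from xy(1,2) have "x j = y j" by (auto simp: PiE_def extensional_def)
      then have "x(j := t) \<noteq> y(j := s)" for t s
        using \<open>x \<noteq> y\<close> by (metis fun_upd_triv fun_upd_upd)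
      then show "range (\<lambda>t. x(j := t)) \<inter> range (\<lambda>t. y(j := t)) = {}" by auto
    qed (rule h)
    then show ?thesis using hD by simp
  qed
  obtain A where A: "\<And>i. finite (A i)" "F \<subseteq> PiE UNIV A"
    using finite_subset_PiE[OF \<open>finite F\<close>] by metis
  have "(\<Sum>k\<in>F. g k powr (real CARD('i) * a)) \<le> (\<Sum>k\<in>PiE UNIV A. g k powr (real CARD('i) * a))"
    using A by (intro sum_mono2 finite_PiE) auto
  also have "\<dots> \<le> (\<Sum>k\<in>PiE UNIV A. \<Prod>j\<in>UNIV. f j k powr a)"
  proof (rule sum_mono)
    fix k
    have "g k powr (real CARD('i) * a) = (\<Prod>j\<in>(UNIV::'i set). g k powr a)"
      using g0[of k] by (simp add: mult.commute flip: powr_powr powr_realpow')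
    also have "\<dots> \<le> (\<Prod>j\<in>UNIV. f j k powr a)"
      using g0 gf a by (intro prod_mono conjI powr_mono2) auto
    finally show "g k powr (real CARD('i) * a) \<le> (\<Prod>j\<in>UNIV. f j k powr a)" .
  qed
  also have "\<dots> \<le> (\<Prod>j\<in>UNIV. (\<Sum>x\<in>PiE (UNIV - {j}) A. f j x) powr a)"
  proof (rule loomis_whitney)
    show "f j (x(j := t)) = f j x" for j x t by (simp add: f_def)
  qed (use A card f0 a_def in auto)
  also have "\<dots> \<le> (\<Prod>j\<in>(UNIV::'i set). D powr a)"
    using fD A a f0 by (intro prod_mono conjI powr_mono2) (auto intro: sum_nonneg)
  also have "\<dots> = D powr (real CARD('i) * a)"
    using D0 by (simp add: mult.commute flip: powr_powr powr_realpow')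
  finally show ?thesis by (simp only: a)
qed

section \<open>Inequalities for real powers\<close>

text \<open>Convexity: \<open>a powr \<gamma>\<close> lies above the tangent at \<open>b\<close>.
  For positive \<open>a\<close> and \<open>b\<close> this is Young's inequality with weights
  \<open>1 - 1 / \<gamma>\<close> and \<open>1 / \<gamma>\<close>. It serves both the estimate of
  differences of powers and Jensen's inequality.\<close>

lemma powr_tangent_le:
  fixes a b \<gamma> :: real
  assumes "0 \<le> a" "0 \<le> b" "1 \<le> \<gamma>"
  shows "\<gamma> * (b powr (\<gamma> - 1) * a) \<le> (\<gamma> - 1) * b powr \<gamma> + a powr \<gamma>"
proof (cases "a = 0 \<or> b = 0")
  case False
  with assms have ab: "0 < a" "0 < b" by auto
  have "(b powr \<gamma>) powr (1 - 1 / \<gamma>) * (a powr \<gamma>) powr (1 / \<gamma>) \<le> (1 - 1 / \<gamma>) * b powr \<gamma> + 1 / \<gamma> * a powr \<gamma>"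
    using ab assms by (intro Youngs_inequality_0) auto
  moreover have "(b powr \<gamma>) powr (1 - 1 / \<gamma>) = b powr (\<gamma> - 1)" "(a powr \<gamma>) powr (1 / \<gamma>) = a"
    using ab assms by (simp_all add: powr_powr algebra_simps)
  ultimately have "\<gamma> * (b powr (\<gamma> - 1) * a) \<le> \<gamma> * ((1 - 1 / \<gamma>) * b powr \<gamma> + 1 / \<gamma> * a powr \<gamma>)"
    using assms by (intro mult_left_mono) auto
  also have "\<dots> = (\<gamma> - 1) * b powr \<gamma> + a powr \<gamma>"
    using assms by (simp add: field_simps)
  finally show ?thesis .
qed (use assms in auto)

lemma powr_minus_one_mult: "0 \<le> b \<Longrightarrow> b powr (\<gamma> - 1) * b = b powr \<gamma>" for b \<gamma> :: real
  by (cases "b = 0") (auto simp: powr_diff)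

text \<open>The tangent at the larger of the two values overestimates the drop to the smaller one;
  by symmetry one may assume \<open>a \<le> b\<close>.\<close>

lemma powr_diff_le:
  fixes a b \<gamma> :: real
  assumes "0 \<le> a" "0 \<le> b" "1 \<le> \<gamma>"
  shows "\<bar>a powr \<gamma> - b powr \<gamma>\<bar> \<le> \<gamma> * (max a b powr (\<gamma> - 1) * \<bar>a - b\<bar>)"
  using assms(1,2)
proof (induction a b rule: linorder_wlog)
  case (le a b)
  have "a powr \<gamma> \<le> b powr \<gamma>" using le assms by (intro powr_mono2) auto
  moreover have "b powr \<gamma> = b powr (\<gamma> - 1) * b"
    using le by (simp add: powr_minus_one_mult)
  ultimately show ?case
    using le powr_tangent_le[of a b \<gamma>] assms by (simp add: max_def algebra_simps)
next
  case (sym a b)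
  then show ?case by (simp add: abs_minus_commute max.commute)
qed

text \<open>A weighted Young inequality that avoids the conjugate exponent of \<open>p\<close> and so covers \<open>p = 1\<close>.\<close>

lemma powr_mult_le_add:
  fixes M c \<delta> p q :: real
  assumes "0 \<le> M" "0 \<le> c" "0 < \<delta>" "1 \<le> p"
  shows "M powr (q * (p - 1) / p) * c \<le> \<delta> * M powr q + \<delta> powr (1 - p) * c powr p"
proof (cases "M = 0")
  case False
  with assms have M: "0 < M" by simp
  \<comment> \<open>With \<open>N\<close> the claim reads \<open>N powr (p - 1) * c \<le> \<delta> *
    N powr p + \<delta> powr (1 - p) * c powr p\<close>; the first term suffices if
    \<open>c \<le> \<delta> * N\<close>, the second otherwise.\<close>
  define N where "N = M powr (q / p)"
  have N: "0 < N" "M powr (q * (p - 1) / p) = N powr (p - 1)" "M powr q = N powr (p - 1) * N"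
  proof -
    show "0 < N" "M powr (q * (p - 1) / p) = N powr (p - 1)"
      using M by (simp_all add: N_def powr_powr)
    then have "N powr (p - 1) * N = N powr p" by (simp add: powr_diff)
    then show "M powr q = N powr (p - 1) * N"
      using assms by (simp add: N_def powr_powr)
  qed
  show ?thesis
  proof (cases "c \<le> \<delta> * N")
    case True
    then have "N powr (p - 1) * c \<le> N powr (p - 1) * (\<delta> * N)"
      using N by (intro mult_left_mono) auto
    also have "\<dots> \<le> \<delta> * M powr q + \<delta> powr (1 - p) * c powr p"
      unfolding N(3) by simp
    finally show ?thesis by (simp add: N)
  next
    case False
    moreover have "0 < \<delta> * N" using assms N by simp
    ultimately have "0 < c" "N \<le> c / \<delta>" using assms by (linarith, simp add: field_simps)
    then have "N powr (p - 1) * c \<le> (c / \<delta>) powr (p - 1) * c"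
      using N assms by (intro mult_right_mono powr_mono2) auto
    also have "\<dots> = \<delta> powr (1 - p) * c powr p"
      using \<open>0 < c\<close> assms by (simp add: powr_divide powr_diff field_simps)
    also have "\<dots> \<le> \<delta> * M powr q + \<delta> powr (1 - p) * c powr p"
      using assms by simp
    finally show ?thesis by (simp add: N)
  qed
qed (use assms in auto)

section \<open>The lattice Sobolev inequality for general \<open>p\<close>\<close>

text \<open>A summable family is bounded, so the excess factor \<open>w k powr (q - p)\<close> is at
  most a constant: the inclusion of \<open>l^p\<close> in \<open>l^q\<close>.\<close>

lemma summable_on_powr_mono:
  fixes w :: "'a \<Rightarrow> real"
  assumes w0: "\<And>k. 0 \<le> w k" and s: "(\<lambda>k. w k powr p) summable_on UNIV" and p: "0 < p" "p \<le> q"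
  shows "(\<lambda>k. w k powr q) summable_on UNIV"
proof -
  define B where "B = (\<Sum>\<^sub>\<infinity>k. w k powr p)"
  have B: "w k powr p \<le> B" for k
    using finite_sum_le_infsum[OF s, of "{k}"] by (simp add: B_def)
  have le: "w k powr q \<le> B powr (q / p - 1) * w k powr p" for k
  proof (cases "w k = 0")
    case False
    then have "w k powr q = (w k powr p) powr (q / p - 1) * w k powr p"
      using p by (simp add: powr_powr field_simps flip: powr_add)
    also have "\<dots> \<le> B powr (q / p - 1) * w k powr p"
      using p B by (intro mult_right_mono powr_mono2) auto
    finally show ?thesis .
  qed simp
  show ?thesis
    by (rule summable_on_comparison_test[OF summable_on_cmult_right[OF s]]) (use le in auto)
qed

lemma bij_shift: "bij (\<lambda>k::'i \<Rightarrow> int. k(j := k j + 1))"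
  by (rule bij_betw_byWitness[where f'="\<lambda>k. k(j := k j - 1)"]) auto

lemma sum_shift_le:
  fixes f :: "('i \<Rightarrow> int) \<Rightarrow> real"
  assumes "f summable_on UNIV" "\<And>k. 0 \<le> f k" "finite F"
  shows "(\<Sum>k\<in>F. f (k(j := k j + 1)) + f k) \<le> 2 * (\<Sum>\<^sub>\<infinity>k. f k)"
proof -
  have "(\<Sum>k\<in>F. f (k(j := k j + 1))) = (\<Sum>k\<in>(\<lambda>k. k(j := k j + 1)) ` F. f k)"
    by (subst sum.reindex) (auto intro: inj_on_subset[OF bij_is_inj[OF bij_shift]])
  also have "\<dots> \<le> (\<Sum>\<^sub>\<infinity>k. f k)"
    using assms by (intro finite_sum_le_infsum) auto
  finally have "(\<Sum>k\<in>F. f (k(j := k j + 1))) \<le> (\<Sum>\<^sub>\<infinity>k. f k)" .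
  moreover have "(\<Sum>k\<in>F. f k) \<le> (\<Sum>\<^sub>\<infinity>k. f k)"
    using assms by (intro finite_sum_le_infsum) auto
  ultimately show ?thesis by (simp add: sum.distrib)
qed

text \<open>The case \<open>p = 1\<close> is applied to \<open>g = w powr \<gamma>\<close>, with
  \<open>\<gamma>\<close> chosen so that \<open>\<gamma> * (n / (n - 1)) = q\<close>. A difference
  of \<open>g\<close> is at most \<open>\<gamma>\<close> times a maximum of \<open>w\<close> to the
  power \<open>\<gamma> - 1 = q * (p - 1) / p\<close> times a difference of \<open>w\<close>.
  Young's inequality splits this into a small multiple of \<open>w powr q\<close>, which is
  absorbed, and the \<open>p\<close>-th power of the difference.\<close>

lemma discrete_sobolev:
  fixes w :: "('i::finite \<Rightarrow> int) \<Rightarrow> real"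
  defines "n \<equiv> real CARD('i)"
  assumes p: "1 \<le> p" "p < n" and q: "q = p * n / (n - p)" and \<gamma>: "\<gamma> = p * (n - 1) / (n - p)"
    and w0: "\<And>k. 0 \<le> w k" and s: "(\<lambda>k. w k powr p) summable_on UNIV"
    and E: "\<And>j F. finite F \<Longrightarrow> (\<Sum>k\<in>F. \<bar>w (k(j := k j + 1)) - w k\<bar> powr p) \<le> E"
  shows "(\<lambda>k. w k powr q) summable_on UNIV"
    and "(\<Sum>\<^sub>\<infinity>k. w k powr q) powr (p / q) \<le> 2 * \<gamma> * (4 * \<gamma>) powr (p - 1) * E"
proof -
  have card: "2 \<le> CARD('i)" using p unfolding n_def by linarith
  have n: "1 < n" "real (CARD('i) - 1) = n - 1" using p card by (auto simp: n_def)
  have \<gamma>1: "1 \<le> \<gamma>" "p \<le> \<gamma>" and q0: "0 < q" and \<gamma>q: "\<gamma> - 1 = q * (p - 1) / p"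
    and pq: "p / q = (n - p) / n"
    using p n unfolding q \<gamma> by (auto simp: field_simps)
  have \<gamma>n: "\<gamma> * (n / (n - 1)) = q" using n by (simp add: q \<gamma>)
  have E0: "0 \<le> E" using E[of "{}"] by simp
  define g where "g k = w k powr \<gamma>" for k
  have g: "g summable_on UNIV"
    unfolding g_def using p \<gamma>1 by (intro summable_on_powr_mono[OF w0 s]) auto
  have gq: "g k powr (n / (n - 1)) = w k powr q" for k
    by (simp only: g_def powr_powr \<gamma>n)
  have gns: "(\<Sum>k\<in>F. w k powr q) \<le> D powr (n / (n - 1))"
    if "finite F" "\<And>j F. finite F \<Longrightarrow> (\<Sum>k\<in>F. \<bar>g (k(j := k j + 1)) - g k\<bar>) \<le> D" for F D
    using gagliardo_nirenberg_discrete[OF card _ g that(2,1)]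
    by (simp only: gq n flip: n_def) (simp add: g_def)
  \<comment> \<open>This crude bound of the variation by the sum of \<open>g\<close> serves only to
    make the sum of \<open>w powr q\<close> finite, without which it could not be absorbed
    below.\<close>
  have "(\<Sum>k\<in>F. \<bar>g (k(j := k j + 1)) - g k\<bar>) \<le> 2 * (\<Sum>\<^sub>\<infinity>k. g k)" if "finite F" for j F
  proof -
    have "(\<Sum>k\<in>F. \<bar>g (k(j := k j + 1)) - g k\<bar>) \<le> (\<Sum>k\<in>F. g (k(j := k j + 1)) + g k)"
      by (intro sum_mono) (auto simp: g_def abs_le_iff intro: add_nonneg_nonneg)
    also have "\<dots> \<le> 2 * (\<Sum>\<^sub>\<infinity>k. g k)"
      using that by (intro sum_shift_le g) (auto simp: g_def)
    finally show ?thesis .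
  qed
  note bound = gns[OF _ this]
  show summ: "(\<lambda>k. w k powr q) summable_on UNIV"
    by (rule nonneg_bdd_above_summable_on) (use bound in \<open>auto intro!: bdd_aboveI\<close>)
  define S where "S = (\<Sum>\<^sub>\<infinity>k. w k powr q)"
  show "S powr (p / q) \<le> 2 * \<gamma> * (4 * \<gamma>) powr (p - 1) * E"
  proof (cases "S = 0")
    \<comment> \<open>The parameter \<open>\<delta>\<close> of the other case is a negative power of
      \<open>S\<close>, so \<open>S = 0\<close> is settled separately.\<close>
    case True
    then show ?thesis using E0 \<gamma>1 by simp
  next
    case False
    moreover have "0 \<le> S" unfolding S_def by (intro infsum_nonneg) simp
    ultimately have S: "0 < S" by simp
    \<comment> \<open>With this choice the term of the gradient estimate that contains \<open>S\<close> is half of the left-hand side.\<close>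
    define \<delta> where "\<delta> = S powr (- 1 / n) / (4 * \<gamma>)"
    have \<delta>: "0 < \<delta>" using S \<gamma>1 by (simp add: \<delta>_def)
    \<comment> \<open>The 2 in \<open>2 * S\<close> arises because every lattice point is both an
      upper and a lower end of an edge in direction \<open>j\<close>.\<close>
    define D where "D = \<gamma> * (\<delta> * (2 * S) + \<delta> powr (1 - p) * E)"
    have D: "(\<Sum>k\<in>F. \<bar>g (k(j := k j + 1)) - g k\<bar>) \<le> D" if "finite F" for j F
    proof -
      have "\<bar>g (k(j := k j + 1)) - g k\<bar> \<le> \<gamma> * (\<delta> * (w (k(j := k j + 1)) powr q + w k powr q)
          + \<delta> powr (1 - p) * \<bar>w (k(j := k j + 1)) - w k\<bar> powr p)" for k
      proof -
        let ?a = "w (k(j := k j + 1))" and ?b = "w k"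
        have "\<bar>g (k(j := k j + 1)) - g k\<bar> \<le> \<gamma> * (max ?a ?b powr (\<gamma> - 1) * \<bar>?a - ?b\<bar>)"
          unfolding g_def by (intro powr_diff_le w0 \<gamma>1)
        also have "\<dots> \<le> \<gamma> * (\<delta> * max ?a ?b powr q + \<delta> powr (1 - p) * \<bar>?a - ?b\<bar> powr p)"
          unfolding \<gamma>q using \<gamma>1 w0 \<delta> p
          by (intro mult_left_mono powr_mult_le_add) (auto simp: le_max_iff_disj)
        also have "\<dots> \<le> \<gamma> * (\<delta> * (?a powr q + ?b powr q) + \<delta> powr (1 - p) * \<bar>?a - ?b\<bar> powr p)"
          using \<gamma>1 \<delta> by (intro mult_left_mono add_right_mono) (auto simp: max_def)
        finally show ?thesis .
      qed
      then have "(\<Sum>k\<in>F. \<bar>g (k(j := k j + 1)) - g k\<bar>)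
        \<le> (\<Sum>k\<in>F. \<gamma> * (\<delta> * (w (k(j := k j + 1)) powr q + w k powr q)
          + \<delta> powr (1 - p) * \<bar>w (k(j := k j + 1)) - w k\<bar> powr p))"
        by (rule sum_mono)
      also have "\<dots> = \<gamma> * (\<delta> * (\<Sum>k\<in>F. w (k(j := k j + 1)) powr q + w k powr q)
          + \<delta> powr (1 - p) * (\<Sum>k\<in>F. \<bar>w (k(j := k j + 1)) - w k\<bar> powr p))"
        by (simp only: sum_distrib_left[symmetric] sum.distrib)
      also have "\<dots> \<le> D"
        unfolding D_def S_def using \<gamma>1 \<delta> that summ
        by (intro mult_left_mono add_mono E sum_shift_le) auto
      finally show ?thesis .
    qed
    have D0: "0 \<le> D" using D[of "{}"] by simp
    have "S \<le> D powr (n / (n - 1))"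
      unfolding S_def using summ gns[OF _ D] by (intro infsum_le_finite_sums) auto
    then have "S powr ((n - 1) / n) \<le> (D powr (n / (n - 1))) powr ((n - 1) / n)"
      using S n by (intro powr_mono2) auto
    also have "\<dots> = D" using n D0 by (simp add: powr_powr)
    also have "D = S powr ((n - 1) / n) / 2 + S powr ((p - 1) / n) * (\<gamma> * (4 * \<gamma>) powr (p - 1) * E)"
    proof -
      have 1: "\<gamma> * (\<delta> * (2 * S)) = S powr ((n - 1) / n) / 2"
      proof -
        have "S powr ((n - 1) / n) = S powr (- 1 / n) * S powr 1"
          unfolding powr_add[symmetric] using n by (simp add: field_simps)
        then show ?thesis using S \<gamma>1 by (simp add: \<delta>_def field_simps)
      qed
      have 2: "\<delta> powr (1 - p) = S powr ((p - 1) / n) * (4 * \<gamma>) powr (p - 1)"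
      proof -
        have "- 1 / n * (1 - p) = (p - 1) / n" using n by (simp add: field_simps)
        then have "\<delta> powr (1 - p) = S powr ((p - 1) / n) / (4 * \<gamma>) powr (1 - p)"
          unfolding \<delta>_def using S \<gamma>1 by (simp add: powr_divide powr_powr)
        also have "\<dots> = S powr ((p - 1) / n) * (4 * \<gamma>) powr (p - 1)"
          using powr_minus_divide[of "4 * \<gamma>" "1 - p"] by simp
        finally show ?thesis .
      qed
      show ?thesis unfolding D_def distrib_left 1 2 by (simp add: algebra_simps)
    qed
    \<comment> \<open>Half of the left-hand side has been absorbed. Dividing by
      \<open>S powr ((p - 1) / n)\<close> leaves the exponent
      \<open>(n - p) / n = p / q\<close>.\<close>
    finally have "S powr ((n - 1) / n) \<le> S powr ((p - 1) / n) * (2 * \<gamma> * (4 * \<gamma>) powr (p - 1) * E)"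
      by (simp add: algebra_simps)
    moreover have "S powr ((n - 1) / n) = S powr ((p - 1) / n) * S powr ((n - p) / n)"
      unfolding powr_add[symmetric] using n by (simp add: field_simps)
    ultimately have "S powr ((n - p) / n) \<le> 2 * \<gamma> * (4 * \<gamma>) powr (p - 1) * E"
      using S by simp
    then show ?thesis by (simp only: pq)
  qed
qed

section \<open>Means over cubes\<close>

lemma sets_borel_cube [measurable]: "cube s k \<in> sets (borel :: (real ^ 'd) measure)"
proof -
  have "cube s k = (\<Inter>j. {x. s * of_int (k $ j) \<le> x $ j} \<inter> {x. x $ j < s * of_int (k $ j) + s})"
    by (auto simp: cube_def)
  also have "\<dots> \<in> sets borel"
    by (intro sets.finite_INT sets.Int borel_closed borel_open closed_halfspace_component_ge_cart
        open_halfspace_component_lt_cart) auto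
  finally show ?thesis .
qed

text \<open>The half-open cube lies between the open and the closed box with the same corners, which
  have equal volume.\<close>

lemma emeasure_cube:
  fixes k :: "int ^ 'd"
  assumes "s > 0"
  shows "emeasure lborel (cube s k) = ennreal (s ^ CARD('d))"
proof (rule antisym)
  define a :: "real ^ 'd" where "a = (\<chi> j. s * of_int (k $ j))"
  define b :: "real ^ 'd" where "b = (\<chi> j. s * of_int (k $ j) + s)"
  have ab: "(\<Prod>i\<in>Basis. (b - a) \<bullet> i) = s ^ CARD('d)" "\<forall>i\<in>Basis. a \<bullet> i \<le> b \<bullet> i"
  proof -
    have "b - a = (\<chi> j. s)" by (simp add: a_def b_def vec_eq_iff)
    moreover have "(\<chi> j. s) \<bullet> i = s" if "i \<in> Basis" for i :: "real ^ 'd"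
      using that by (auto simp: Basis_vec_def inner_axis)
    ultimately show "(\<Prod>i\<in>Basis. (b - a) \<bullet> i) = s ^ CARD('d)" by simp
    show "\<forall>i\<in>Basis. a \<bullet> i \<le> b \<bullet> i"
      using assms by (auto simp: Basis_vec_def inner_axis a_def b_def)
  qed
  have "box a b \<subseteq> cube s k" "cube s k \<subseteq> cbox a b"
    by (auto simp: cube_def a_def b_def mem_box_cart less_imp_le)
  then have "emeasure lborel (box a b) \<le> emeasure lborel (cube s k)"
    and "emeasure lborel (cube s k) \<le> emeasure lborel (cbox a b)"
    by (auto intro!: emeasure_mono)
  then show "ennreal (s ^ CARD('d)) \<le> emeasure lborel (cube s k)"
    and "emeasure lborel (cube s k) \<le> ennreal (s ^ CARD('d))"
    using ab by (simp_all add: emeasure_lborel_box_eq emeasure_lborel_cbox_eq)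
qed

text \<open>In the direction \<open>j\<close> of adjacency the coordinates differ by less than
  \<open>2 * s\<close>, in the others by less than \<open>s\<close>, so the squared distance is
  below \<open>(4 + (CARD('d) - 1)) * s\<^sup>2\<close>. This is the origin of the number
  \<open>CARD('d) + 3\<close>.\<close>

lemma norm_diff_adjacent_cubes:
  fixes x z :: "real ^ 'd"
  assumes x: "x \<in> cube s (vec_lambda k)" and z: "z \<in> cube s (vec_lambda (k(j := k j + 1)))"
  shows "norm (z - x) < s * sqrt (real CARD('d) + 3)"
proof -
  have xz: "s * of_int (k i) \<le> x $ i \<and> x $ i < s * of_int (k i) + s"
    "s * of_int ((k(j := k j + 1)) i) \<le> z $ i \<and> z $ i < s * of_int ((k(j := k j + 1)) i) + s" for i
    using x z by (simp_all add: cube_def)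
  have s: "0 < s" using xz(1)[of j] by linarith
  have lt: "(z $ i - x $ i)\<^sup>2 < (if i = j then 4 * s\<^sup>2 else s\<^sup>2)" for i
  proof (cases "i = j")
    case True
    have "\<bar>z $ j - x $ j\<bar> < 2 * s" using xz[of j] by (simp add: algebra_simps)
    then have "\<bar>z $ j - x $ j\<bar>\<^sup>2 < (2 * s)\<^sup>2" by (intro power_strict_mono) auto
    then show ?thesis using True by (simp add: power_mult_distrib)
  next
    case False
    then have "\<bar>z $ i - x $ i\<bar> < s" using xz[of i] by (simp add: abs_less_iff)
    then have "\<bar>z $ i - x $ i\<bar>\<^sup>2 < s\<^sup>2" by (intro power_strict_mono) auto
    then show ?thesis using False by simp
  qed
  have "(norm (z - x))\<^sup>2 = (\<Sum>i\<in>UNIV. (z $ i - x $ i)\<^sup>2)"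
    by (simp add: norm_vec_def L2_set_def sum_nonneg)
  also have "\<dots> < (\<Sum>i\<in>UNIV. if i = j then 4 * s\<^sup>2 else s\<^sup>2)"
    using lt by (intro sum_strict_mono) auto
  also have "\<dots> = (\<Sum>i\<in>(UNIV::'d set). s\<^sup>2 + (if i = j then 3 * s\<^sup>2 else 0))"
    by (intro sum.cong) auto
  also have "\<dots> = (s * sqrt (real CARD('d) + 3))\<^sup>2"
    by (simp add: sum.distrib power_mult_distrib algebra_simps)
  finally show ?thesis
    by (rule power2_less_imp_less) (use s in simp)
qed

section \<open>Jensen's inequality and comparison with the nonlocal energy\<close>

text \<open>Jensen's inequality by integrating the tangent inequality for the power at the mean.
  Integrability of \<open>h\<close> comes from \<open>h x \<le> 1 + h x powr p\<close> and the
  finite measure of \<open>A\<close>; it makes the Bochner integral agree with the nonnegative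
  one.\<close>

lemma jensen_powr_nn_integral:
  fixes h :: "'a \<Rightarrow> real"
  assumes A[measurable]: "A \<in> sets M" and V: "emeasure M A = ennreal V" "0 < V" and p: "1 \<le> p"
    and h[measurable]: "h \<in> borel_measurable M" and h0: "\<And>x. 0 \<le> h x"
    and fin: "(\<integral>\<^sup>+x\<in>A. ennreal (h x powr p) \<partial>M) < \<infinity>"
  shows "set_integrable M A h"
    and "ennreal (V * ((LINT x:A|M. h x) / V) powr p) \<le> (\<integral>\<^sup>+x\<in>A. ennreal (h x powr p) \<partial>M)"
    and "(\<integral>\<^sup>+x\<in>A. ennreal (h x) \<partial>M) = ennreal (LINT x:A|M. h x)"
proof -
  have ind: "(\<lambda>x. ennreal (f x) * indicator A x) = (\<lambda>x. ennreal (indicator A x * f x))" for f :: "'a \<Rightarrow> real"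
    by (auto split: split_indicator)
  have intp: "integrable M (\<lambda>x. indicator A x * h x powr p)"
    using fin[unfolded ind] by (intro integrableI_nonneg) auto
  have one: "integrable M (\<lambda>x. indicator A x * c)" for c :: real
    using V by (intro integrable_mult_left integrable_real_indicator) auto
  have "h x \<le> 1 + h x powr p" for x
  proof (cases "h x \<le> 1")
    case False
    then have "h x powr 1 \<le> h x powr p" using p by (intro powr_mono) auto
    then show ?thesis using False by simp
  qed (simp add: add_increasing2)
  then have le: "indicator A x * h x \<le> indicator A x * 1 + indicator A x * h x powr p" for x
    by (auto split: split_indicator)
  have int: "integrable M (\<lambda>x. indicator A x * h x)"
    by (rule Bochner_Integration.integrable_bound[OF Bochner_Integration.integrable_add[OF one[of 1] intp]])
      (use le h0 in \<open>auto intro!: AE_I2 order_trans[OF _ abs_ge_self] simp: abs_mult\<close>)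
  then show 1: "set_integrable M A h" by (simp add: set_integrable_def)
  show "(\<integral>\<^sup>+x\<in>A. ennreal (h x) \<partial>M) = ennreal (LINT x:A|M. h x)"
    unfolding set_lebesgue_integral_def ind using int h0
    by (subst nn_integral_eq_integral) auto
  define c where "c = (LINT x:A|M. h x) / V"
  have c: "0 \<le> c" "(\<integral>x. indicator A x * h x \<partial>M) = c * V"
    using V h0 by (auto simp: c_def set_lebesgue_integral_def intro!: divide_nonneg_pos integral_nonneg)
  \<comment> \<open>The tangent at the mean \<open>c\<close>: the left side integrates to
    \<open>p * c powr p * V\<close>, and moving \<open>(p - 1) * c powr p * V\<close> over leaves
    the claim.\<close>
  have "(\<integral>x. p * c powr (p - 1) * (indicator A x * h x) \<partial>M)
      \<le> (\<integral>x. indicator A x * ((p - 1) * c powr p) + indicator A x * h x powr p \<partial>M)"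
  proof (intro integral_mono integrable_mult_right int Bochner_Integration.integrable_add one intp)
    show "p * c powr (p - 1) * (indicator A x * h x)
        \<le> indicator A x * ((p - 1) * c powr p) + indicator A x * h x powr p" for x
      using powr_tangent_le[of "h x" c p] h0 c p by (auto split: split_indicator)
  qed
  also have "\<dots> = V * ((p - 1) * c powr p) + (\<integral>x. indicator A x * h x powr p \<partial>M)"
    using V one intp by (simp add: measure_def)
  also have "(\<integral>x. p * c powr (p - 1) * (indicator A x * h x) \<partial>M) = p * c powr (p - 1) * (c * V)"
    by (simp only: integral_mult_right_zero c(2))
  finally have "p * (c powr (p - 1) * c) * V \<le> V * ((p - 1) * c powr p) + (\<integral>x. indicator A x * h x powr p \<partial>M)"
    by (simp add: mult_ac)
  then have "V * c powr p \<le> (\<integral>x. indicator A x * h x powr p \<partial>M)"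
    unfolding powr_minus_one_mult[OF c(1)] by (simp add: algebra_simps)
  then show "ennreal (V * ((LINT x:A|M. h x) / V) powr p) \<le> (\<integral>\<^sup>+x\<in>A. ennreal (h x powr p) \<partial>M)"
    unfolding ind c_def[symmetric] using intp
    by (subst nn_integral_eq_integral) (auto intro: ennreal_leI)
qed

lemma nn_integral_lborel_affine:
  fixes t :: "'a::euclidean_space"
  assumes [measurable]: "f \<in> borel_measurable borel" and c: "c \<noteq> 0"
  shows "(\<integral>\<^sup>+x. f x \<partial>lborel) = ennreal (\<bar>c\<bar> ^ DIM('a)) * (\<integral>\<^sup>+x. f (t + c *\<^sub>R x) \<partial>lborel)"
  by (subst lborel_affine[OF c, of t])
    (simp add: nn_integral_density nn_integral_distr nn_integral_cmult)

text \<open>The products of adjacent cubes are disjoint for different \<open>k\<close>, since their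
  first factors are, and consist of pairs at distance less than \<open>r * \<epsilon>\<close>.
  Substituting \<open>z = x + \<epsilon> *\<^sub>R \<xi>\<close> produces
  \<open>\<epsilon> ^ CARD('d)\<close>, and Tonelli's theorem moves \<open>\<xi>\<close>
  outside.\<close>

lemma sum_adjacent_cubes_le_energy:
  fixes U :: "real ^ 'd \<Rightarrow> real"
  assumes U[measurable]: "U \<in> borel_measurable borel"
    and pos: "0 < s" "0 < \<epsilon>" and r: "s * sqrt (real CARD('d) + 3) = r * \<epsilon>" and "finite F"
  shows "(\<Sum>k\<in>F. \<integral>\<^sup>+y\<in>cube s (vec_lambda k) \<times> cube s (vec_lambda (k(j := k j + 1))).
            ennreal (\<bar>U (snd y) - U (fst y)\<bar> powr p) \<partial>(lborel \<Otimes>\<^sub>M lborel))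
    \<le> ennreal (\<epsilon> ^ CARD('d)) *
        (\<integral>\<^sup>+\<xi>\<in>ball 0 r. (\<integral>\<^sup>+x. ennreal (\<bar>U (x + \<epsilon> *\<^sub>R \<xi>) - U x\<bar> powr p) \<partial>lborel) \<partial>lborel)"
proof -
  define H where "H x z = ennreal (\<bar>U z - U x\<bar> powr p)" for x z
  have H[measurable]: "(\<lambda>y. H (f y) (g y)) \<in> borel_measurable N"
    if [measurable]: "f \<in> borel_measurable N" "g \<in> borel_measurable N" for f g and N :: "'z measure"
    unfolding H_def by measurable
  have [measurable]: "ball 0 r \<in> sets (borel :: (real ^ 'd) measure)" by simp
  let ?Q = "\<lambda>k. cube s (vec_lambda k) :: (real ^ 'd) set"
  let ?Q' = "\<lambda>k. cube s (vec_lambda (k(j := k j + 1))) :: (real ^ 'd) set"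
  have near: "(\<Sum>k\<in>F. H x z * indicator (?Q k \<times> ?Q' k) (x, z)) \<le> H x z * indicator (ball 0 (r * \<epsilon>)) (z - x)" for x z
  proof (cases "\<exists>k\<in>F. x \<in> ?Q k \<and> z \<in> ?Q' k")
    case False
    then have "(\<Sum>k\<in>F. H x z * indicator (?Q k \<times> ?Q' k) (x, z)) = 0"
      by (intro sum.neutral) (auto split: split_indicator)
    then show ?thesis by simp
  next
    case True
    then obtain k where k: "k \<in> F" "x \<in> ?Q k" "z \<in> ?Q' k" by blast
    have "x \<notin> ?Q l" if "l \<noteq> k" for l
      using k(2) that mem_cube_iff[OF pos(1), of x] by (metis vec_lambda_inverse UNIV_I)
    then have "(\<Sum>l\<in>F - {k}. H x z * indicator (?Q l \<times> ?Q' l) (x, z)) = 0"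
      by (intro sum.neutral) (auto split: split_indicator)
    then have "(\<Sum>k\<in>F. H x z * indicator (?Q k \<times> ?Q' k) (x, z)) \<le> H x z"
      using k \<open>finite F\<close> by (subst sum.remove[of _ k]) (auto split: split_indicator)
    moreover have "z - x \<in> ball 0 (r * \<epsilon>)"
      using norm_diff_adjacent_cubes[OF k(2,3)] by (simp add: r)
    ultimately show ?thesis by simp
  qed
  have "(\<Sum>k\<in>F. \<integral>\<^sup>+y\<in>?Q k \<times> ?Q' k. ennreal (\<bar>U (snd y) - U (fst y)\<bar> powr p) \<partial>(lborel \<Otimes>\<^sub>M lborel))
      = (\<Sum>k\<in>F. \<integral>\<^sup>+x. \<integral>\<^sup>+z. H x z * indicator (?Q k \<times> ?Q' k) (x, z) \<partial>lborel \<partial>lborel)"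
    by (intro sum.cong refl, subst lborel.nn_integral_fst[symmetric]) (auto simp: H_def)
  also have "\<dots> = (\<integral>\<^sup>+x. \<integral>\<^sup>+z. (\<Sum>k\<in>F. H x z * indicator (?Q k \<times> ?Q' k) (x, z)) \<partial>lborel \<partial>lborel)"
    by (simp add: nn_integral_sum)
  also have "\<dots> \<le> (\<integral>\<^sup>+x. \<integral>\<^sup>+z. H x z * indicator (ball 0 (r * \<epsilon>)) (z - x) \<partial>lborel \<partial>lborel)"
    by (intro nn_integral_mono near)
  also have "\<dots> = (\<integral>\<^sup>+x. ennreal (\<epsilon> ^ CARD('d)) * (\<integral>\<^sup>+\<xi>. H x (x + \<epsilon> *\<^sub>R \<xi>) * indicator (ball 0 r) \<xi> \<partial>lborel) \<partial>lborel)"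
  proof (rule nn_integral_cong)
    fix x :: "real ^ 'd"
    have "(\<integral>\<^sup>+z. H x z * indicator (ball 0 (r * \<epsilon>)) (z - x) \<partial>lborel)
        = ennreal (\<epsilon> ^ CARD('d)) * (\<integral>\<^sup>+\<xi>. H x (x + \<epsilon> *\<^sub>R \<xi>) * indicator (ball 0 (r * \<epsilon>)) (\<epsilon> *\<^sub>R \<xi>) \<partial>lborel)"
      using pos by (subst nn_integral_lborel_affine[where c=\<epsilon> and t=x]) (measurable, simp_all)
    also have "(\<lambda>\<xi>::real ^ 'd. indicator (ball 0 (r * \<epsilon>)) (\<epsilon> *\<^sub>R \<xi>) :: ennreal) = indicator (ball 0 r)"
      using pos by (auto simp: indicator_def fun_eq_iff mult.commute)
    finally show "(\<integral>\<^sup>+z. H x z * indicator (ball 0 (r * \<epsilon>)) (z - x) \<partial>lborel)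
        = ennreal (\<epsilon> ^ CARD('d)) * (\<integral>\<^sup>+\<xi>. H x (x + \<epsilon> *\<^sub>R \<xi>) * indicator (ball 0 r) \<xi> \<partial>lborel)"
      by (simp add: fun_eq_iff)
  qed
  also have "\<dots> = ennreal (\<epsilon> ^ CARD('d)) * (\<integral>\<^sup>+x. \<integral>\<^sup>+\<xi>. H x (x + \<epsilon> *\<^sub>R \<xi>) * indicator (ball 0 r) \<xi> \<partial>lborel \<partial>lborel)"
    by (intro nn_integral_cmult) measurable
  also have "(\<integral>\<^sup>+x. \<integral>\<^sup>+\<xi>. H x (x + \<epsilon> *\<^sub>R \<xi>) * indicator (ball 0 r) \<xi> \<partial>lborel \<partial>lborel)
      = (\<integral>\<^sup>+\<xi>. \<integral>\<^sup>+x. H x (x + \<epsilon> *\<^sub>R \<xi>) * indicator (ball 0 r) \<xi> \<partial>lborel \<partial>lborel)"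
    by (rule lborel_pair.Fubini') measurable
  also have "\<dots> = (\<integral>\<^sup>+\<xi>\<in>ball 0 r. (\<integral>\<^sup>+x. H x (x + \<epsilon> *\<^sub>R \<xi>) \<partial>lborel) \<partial>lborel)"
    by (intro nn_integral_cong nn_integral_multc) measurable
  finally show ?thesis by (simp only: H_def)
qed

text \<open>The cubes tile the space. The value at \<open>x\<close> is a sum over all lattice points
  with at most one nonzero term, and as there are countably many of them, sum and integral may be
  exchanged.\<close>

lemma nn_integral_piecewise_constant:
  fixes f :: "('d::finite \<Rightarrow> int) \<Rightarrow> ennreal"
  assumes s: "0 < s"
  shows "(\<integral>\<^sup>+x. f (vec_nth (cube_index s x)) \<partial>lborel) = ennreal (s ^ CARD('d)) * (\<integral>\<^sup>+k. f k \<partial>count_space UNIV)"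
proof -
  have "countable (UNIV :: ('d \<Rightarrow> int) set)"
    using countable_PiE[of "UNIV::'d set" "\<lambda>_. UNIV :: int set"] by auto
  note swap = nn_integral_count_space_nn_integral[OF this]
  have mem: "x \<in> cube s (vec_lambda k) \<longleftrightarrow> k = vec_nth (cube_index s x)" for x :: "real ^ 'd" and k
    using mem_cube_iff[OF s, of x "vec_lambda k"] by (metis vec_lambda_inverse vec_nth_inverse UNIV_I)
  have ind: "indicator (cube s (vec_lambda k)) x = (if k = vec_nth (cube_index s x) then 1 else 0 :: ennreal)"
    for x :: "real ^ 'd" and k
    unfolding indicator_def mem by simp
  have "f (vec_nth (cube_index s x)) = (\<integral>\<^sup>+k. f k * indicator (cube s (vec_lambda k)) x \<partial>count_space UNIV)" for x :: "real ^ 'd"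
    by (subst nn_integral_count_space'[where A="{vec_nth (cube_index s x)}"]) (auto simp: ind mem_cube_iff[OF s])
  then have "(\<integral>\<^sup>+x. f (vec_nth (cube_index s x)) \<partial>lborel)
      = (\<integral>\<^sup>+x. \<integral>\<^sup>+k. f k * indicator (cube s (vec_lambda k)) x \<partial>count_space UNIV \<partial>(lborel :: (real ^ 'd) measure))"
    by simp
  also have "\<dots> = (\<integral>\<^sup>+k. \<integral>\<^sup>+x. f k * indicator (cube s (vec_lambda k)) x \<partial>(lborel :: (real ^ 'd) measure) \<partial>count_space UNIV)"
    by (rule swap) measurable
  also have "\<dots> = (\<integral>\<^sup>+k. ennreal (s ^ CARD('d)) * f k \<partial>count_space UNIV)"
    using s by (simp add: nn_integral_cmult_indicator emeasure_cube mult.commute)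
  finally show ?thesis by (simp add: nn_integral_cmult)
qed

text \<open>\<open>b - a\<close> is the mean of \<open>U z - U x\<close> over pairs in
  \<open>A \<times> B\<close>, hence in modulus at most the mean \<open>c\<close> of the absolute
  value; Jensen's inequality on the product then brings in the power. If the right-hand side is
  infinite there is nothing to show.\<close>

lemma abs_diff_means_powr_le:
  fixes U :: "'a::euclidean_space \<Rightarrow> real"
  assumes U[measurable]: "U \<in> borel_measurable borel" and U0: "\<And>x. 0 \<le> U x" and p: "1 \<le> p" and V: "0 < V"
    and A[measurable]: "A \<in> sets borel" "emeasure lborel A = ennreal V" "(\<integral>\<^sup>+x\<in>A. ennreal (U x) \<partial>lborel) = ennreal (V * a)"
    and B[measurable]: "B \<in> sets borel" "emeasure lborel B = ennreal V" "(\<integral>\<^sup>+x\<in>B. ennreal (U x) \<partial>lborel) = ennreal (V * b)"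
    and ab: "0 \<le> a" "0 \<le> b"
  shows "ennreal (V\<^sup>2 * \<bar>b - a\<bar> powr p)
    \<le> (\<integral>\<^sup>+y\<in>A \<times> B. ennreal (\<bar>U (snd y) - U (fst y)\<bar> powr p) \<partial>(lborel \<Otimes>\<^sub>M lborel))" (is "_ \<le> ?I")
proof (cases "?I < \<infinity>")
  case True
  let ?M = "lborel \<Otimes>\<^sub>M lborel :: ('a \<times> 'a) measure"
  let ?h = "\<lambda>y. \<bar>U (snd y) - U (fst y)\<bar>"
  have AB: "emeasure ?M (A \<times> B) = ennreal (V\<^sup>2)"
    using V by (simp add: lborel.emeasure_pair_measure_Times A B power2_eq_square ennreal_mult)
  define c where "c = (LINT y:A \<times> B|?M. ?h y) / V\<^sup>2"
  note J = jensen_powr_nn_integral[OF _ AB _ p _ _ True]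
  have c1: "ennreal (V\<^sup>2 * c powr p) \<le> ?I"
    unfolding c_def using V by (intro J) auto
  have "(\<integral>\<^sup>+y\<in>A \<times> B. ennreal (?h y) \<partial>?M) = ennreal (LINT y:A \<times> B|?M. ?h y)"
    using V by (intro J) auto
  then have c2: "(\<integral>\<^sup>+y\<in>A \<times> B. ennreal (?h y) \<partial>?M) = ennreal (V\<^sup>2 * c)"
    using V by (simp add: c_def)
  have c0: "0 \<le> c"
    unfolding c_def set_lebesgue_integral_def using V by (intro divide_nonneg_pos integral_nonneg) auto
  have If: "(\<integral>\<^sup>+y\<in>A \<times> B. ennreal (U (fst y)) \<partial>?M) = ennreal (V\<^sup>2 * a)"
  proof -
    have "(\<integral>\<^sup>+y\<in>A \<times> B. ennreal (U (fst y)) \<partial>?M)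
        = (\<integral>\<^sup>+x. \<integral>\<^sup>+z. ennreal (U x) * indicator A x * indicator B z \<partial>lborel \<partial>lborel)"
      by (subst lborel.nn_integral_fst[symmetric]) (auto simp: indicator_times mult_ac)
    also have "\<dots> = (\<integral>\<^sup>+x. ennreal (U x) * indicator A x * ennreal V \<partial>lborel)"
      by (intro nn_integral_cong) (simp add: nn_integral_cmult B)
    also have "\<dots> = ennreal (V * a) * ennreal V"
      by (simp add: nn_integral_multc A)
    finally show ?thesis using V ab by (simp add: power2_eq_square mult_ac flip: ennreal_mult)
  qed
  have Is: "(\<integral>\<^sup>+y\<in>A \<times> B. ennreal (U (snd y)) \<partial>?M) = ennreal (V\<^sup>2 * b)"
  proof -
    have "(\<integral>\<^sup>+y\<in>A \<times> B. ennreal (U (snd y)) \<partial>?M)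
        = (\<integral>\<^sup>+x. \<integral>\<^sup>+z. indicator A x * (ennreal (U z) * indicator B z) \<partial>lborel \<partial>lborel)"
      by (subst lborel.nn_integral_fst[symmetric]) (auto simp: indicator_times mult_ac)
    also have "\<dots> = (\<integral>\<^sup>+x. indicator A x * ennreal (V * b) \<partial>lborel)"
      by (intro nn_integral_cong) (simp add: nn_integral_cmult B del: nn_integral_indicator)
    also have "\<dots> = ennreal V * ennreal (V * b)"
      by (simp add: nn_integral_multc A)
    finally show ?thesis using V ab by (simp add: power2_eq_square mult_ac flip: ennreal_mult)
  qed
  \<comment> \<open>Used twice with the roles of the two coordinates exchanged: this treats both
    signs of \<open>b - a\<close> by additions alone and avoids subtracting extended nonnegative
    integrals.\<close>
  have "(\<integral>\<^sup>+y\<in>A \<times> B. ennreal (f y) \<partial>?M) \<le> (\<integral>\<^sup>+y\<in>A \<times> B. ennreal (g y) \<partial>?M) + (\<integral>\<^sup>+y\<in>A \<times> B. ennreal (?h y) \<partial>?M)"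
    if [measurable]: "g \<in> borel_measurable ?M" "f \<in> borel_measurable ?M"
      and "\<And>y. f y \<le> g y + ?h y" "\<And>y. 0 \<le> g y" for f g
  proof -
    have "(\<integral>\<^sup>+y\<in>A \<times> B. ennreal (f y) \<partial>?M) \<le> (\<integral>\<^sup>+y. ennreal (g y) * indicator (A \<times> B) y + ennreal (?h y) * indicator (A \<times> B) y \<partial>?M)"
      using that(3,4) by (intro nn_integral_mono) (auto split: split_indicator simp flip: ennreal_plus intro: ennreal_leI)
    also have "\<dots> = (\<integral>\<^sup>+y\<in>A \<times> B. ennreal (g y) \<partial>?M) + (\<integral>\<^sup>+y\<in>A \<times> B. ennreal (?h y) \<partial>?M)"
      by (intro nn_integral_add) measurable
    finally show ?thesis .
  qed
  note this[of "\<lambda>y. U (fst y)" "\<lambda>y. U (snd y)"] this[of "\<lambda>y. U (snd y)" "\<lambda>y. U (fst y)"]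
  then have "ennreal (V\<^sup>2 * b) \<le> ennreal (V\<^sup>2 * a) + ennreal (V\<^sup>2 * c)"
    and "ennreal (V\<^sup>2 * a) \<le> ennreal (V\<^sup>2 * b) + ennreal (V\<^sup>2 * c)"
    using U0 unfolding If Is c2 by auto
  then have "V\<^sup>2 * b \<le> V\<^sup>2 * (a + c)" "V\<^sup>2 * a \<le> V\<^sup>2 * (b + c)"
    using V ab c0 by (simp_all add: distrib_left flip: ennreal_plus)
  then have "\<bar>b - a\<bar> \<le> c" using V by (simp add: mult_le_cancel_left_pos)
  then have "ennreal (V\<^sup>2 * \<bar>b - a\<bar> powr p) \<le> ennreal (V\<^sup>2 * c powr p)"
    using V p by (intro ennreal_leI mult_left_mono powr_mono2) auto
  then show ?thesis using c1 by (rule order_trans)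
next
  case False
  then have "?I = \<infinity>" by (simp only: not_less infinity_ennreal_def top_unique)
  then show ?thesis by simp
qed

lemma nn_integral_count_space_eq_infsum:
  fixes f :: "'a \<Rightarrow> real"
  assumes "f summable_on UNIV" "\<And>x. 0 \<le> f x"
  shows "(\<integral>\<^sup>+x. ennreal (f x) \<partial>count_space UNIV) = ennreal (\<Sum>\<^sub>\<infinity>x. f x)"
proof -
  have "Infinite_Set_Sum.abs_summable_on f UNIV"
    using assms by (subst abs_summable_equivalent[symmetric]) simp
  then show ?thesis
    using assms nn_integral_conv_infsetsum[of f UNIV] infsetsum_infsum[of f UNIV] by simp
qed

section \<open>The inequality for scalar functions\<close>

text \<open>Jensen's inequality on the cubes makes \<open>w powr p\<close> summable, and comparison
  with the energy bounds the differences of \<open>w\<close>, so the lattice inequality applies.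
  Back on the whole space every power of \<open>\<epsilon>\<close> cancels, which leaves a constant
  in \<open>\<rho>\<close>, \<open>p\<close> and the dimension.\<close>

lemma sobolev_piecewise_means:
  fixes U :: "real ^ 'd \<Rightarrow> real"
  assumes U[measurable]: "U \<in> borel_measurable borel" and U0: "\<And>x. 0 \<le> U x"
    and Lp: "(\<integral>\<^sup>+x. ennreal (U x powr p) \<partial>lborel) < \<infinity>"
    and p: "1 \<le> p" "p < real CARD('d)" and q: "q = p * real CARD('d) / (real CARD('d) - p)"
    and \<gamma>: "\<gamma> = p * (real CARD('d) - 1) / (real CARD('d) - p)"
    and \<rho>: "0 < \<rho>" "\<rho> * sqrt (real CARD('d) + 3) = r" and \<epsilon>: "0 < \<epsilon>"
  defines "s \<equiv> \<rho> * \<epsilon>"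
  defines "w \<equiv> \<lambda>k. (LINT x:cube s (vec_lambda k)|lborel. U x) / s ^ CARD('d)"
  shows "ennreal_powr (\<integral>\<^sup>+x. ennreal (w (vec_nth (cube_index s x)) powr q) \<partial>lborel) (p / q)
    \<le> ennreal (2 * \<gamma> * (4 * \<gamma>) powr (p - 1) / (\<rho> powr p * \<rho> ^ CARD('d))) *
      (\<integral>\<^sup>+\<xi>\<in>ball 0 r. (\<integral>\<^sup>+x. ennreal (\<bar>(U (x + \<epsilon> *\<^sub>R \<xi>) - U x) / \<epsilon>\<bar> powr p) \<partial>lborel) \<partial>lborel)"
    (is "_ \<le> ennreal ?C * ?G")
proof (cases "?G = \<infinity>")
  \<comment> \<open>For \<open>ennreal\<close>, \<open>\<infinity>\<close> times 0 is 0, so it is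
    \<open>0 < ?C\<close> that makes the bound trivial here.\<close>
  case True
  have "0 < \<gamma>" using p unfolding \<gamma> by simp
  then have "0 < ?C" using \<rho> by simp
  then have "ennreal ?C * ?G = \<infinity>" unfolding True by (simp only: ennreal_mult_eq_top_iff infinity_ennreal_def ennreal_eq_0_iff) simp
  then show ?thesis by (simp only: infinity_ennreal_def top_greatest)
next
  case False
  then obtain g where g: "?G = ennreal g" "0 \<le> g" by (cases ?G) auto
  have s: "0 < s" using \<rho> \<epsilon> by (simp add: s_def)
  have r: "s * sqrt (real CARD('d) + 3) = r * \<epsilon>" using \<rho> by (auto simp: s_def mult_ac)
  define V where "V = s ^ CARD('d)"
  have V: "0 < V" using s by (simp add: V_def)
  let ?Q = "\<lambda>k. cube s (vec_lambda k) :: (real ^ 'd) set"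
  have emQ: "emeasure lborel (cube s k :: (real ^ 'd) set) = ennreal V" for k
    using emeasure_cube[OF s] by (simp add: V_def)
  have finQ: "(\<integral>\<^sup>+x\<in>cube s k. ennreal (U x powr p) \<partial>lborel) < \<infinity>" for k
    by (rule le_less_trans[OF _ Lp]) (intro nn_integral_mono, auto split: split_indicator)
  have Qm: "cube s k \<in> sets (lborel :: (real ^ 'd) measure)" for k by simp
  note J = jensen_powr_nn_integral[OF Qm emQ V p(1) _ _ finQ]
  have w0: "0 \<le> w k" for k
    unfolding w_def set_lebesgue_integral_def using s U0 by (intro divide_nonneg_pos integral_nonneg) auto
  have wint: "(\<integral>\<^sup>+x\<in>?Q k. ennreal (U x) \<partial>lborel) = ennreal (V * w k)" for k
    using J(3)[of "vec_lambda k"] U0 s by (simp add: w_def V_def)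
  have wp: "ennreal (V * w k powr p) \<le> (\<integral>\<^sup>+x\<in>?Q k. ennreal (U x powr p) \<partial>lborel)" for k
    using J(2)[of "vec_lambda k"] U0 by (simp add: w_def V_def)
  define L where "L = enn2real (\<integral>\<^sup>+x. ennreal (U x powr p) \<partial>lborel)"
  have L: "(\<integral>\<^sup>+x. ennreal (U x powr p) \<partial>lborel) = ennreal L"
    using Lp by (simp add: L_def)
  have idx: "x \<in> ?Q k \<longleftrightarrow> k = vec_nth (cube_index s x)" for x k
    using mem_cube_iff[OF s, of x "vec_lambda k"] by (metis vec_lambda_inverse vec_nth_inverse UNIV_I)
  have "(\<Sum>k\<in>F. w k powr p) \<le> L / V" if "finite F" for F
  proof -
    have "ennreal (\<Sum>k\<in>F. V * w k powr p) = (\<Sum>k\<in>F. ennreal (V * w k powr p))"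
      using V by (simp add: sum_ennreal)
    also have "\<dots> \<le> (\<Sum>k\<in>F. \<integral>\<^sup>+x\<in>?Q k. ennreal (U x powr p) \<partial>lborel)"
      by (intro sum_mono wp)
    also have "\<dots> = (\<integral>\<^sup>+x. (\<Sum>k\<in>F. ennreal (U x powr p) * indicator (?Q k) x) \<partial>lborel)"
      by (simp add: nn_integral_sum)
    also have "\<dots> \<le> (\<integral>\<^sup>+x. ennreal (U x powr p) \<partial>lborel)"
    proof (intro nn_integral_mono)
      fix x
      have "(\<Sum>k\<in>F. ennreal (U x powr p) * indicator (?Q k) x)
          = (\<Sum>k\<in>F. if k = vec_nth (cube_index s x) then ennreal (U x powr p) else 0)"
        unfolding indicator_def idx by (intro sum.cong) auto
      also have "\<dots> \<le> ennreal (U x powr p)"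
        using that by simp
      finally show "(\<Sum>k\<in>F. ennreal (U x powr p) * indicator (?Q k) x) \<le> ennreal (U x powr p)" .
    qed
    finally have "(\<Sum>k\<in>F. V * w k powr p) \<le> L"
      unfolding L by (simp add: L_def)
    then show ?thesis using V by (simp add: field_simps flip: sum_distrib_left)
  qed
  then have summ: "(\<lambda>k. w k powr p) summable_on UNIV"
    by (intro nonneg_bdd_above_summable_on) (auto intro!: bdd_aboveI)
  \<comment> \<open>\<open>V\<^sup>2\<close> stems from averaging over two cubes,
    \<open>\<epsilon> ^ CARD('d)\<close> from the substitution
    \<open>z = x + \<epsilon> *\<^sub>R \<xi>\<close>, and \<open>\<epsilon> powr p\<close> from the
    difference quotient in \<open>?G\<close>.\<close>
  define E where "E = \<epsilon> ^ CARD('d) * (\<epsilon> powr p * g) / V\<^sup>2"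
  have E: "(\<Sum>k\<in>F. \<bar>w (k(j := k j + 1)) - w k\<bar> powr p) \<le> E" if "finite F" for j F
  proof -
    have "ennreal (\<Sum>k\<in>F. V\<^sup>2 * \<bar>w (k(j := k j + 1)) - w k\<bar> powr p)
        = (\<Sum>k\<in>F. ennreal (V\<^sup>2 * \<bar>w (k(j := k j + 1)) - w k\<bar> powr p))"
      by (simp add: sum_ennreal)
    also have "\<dots> \<le> (\<Sum>k\<in>F. \<integral>\<^sup>+y\<in>?Q k \<times> ?Q (k(j := k j + 1)).
        ennreal (\<bar>U (snd y) - U (fst y)\<bar> powr p) \<partial>(lborel \<Otimes>\<^sub>M lborel))"
      by (intro sum_mono abs_diff_means_powr_le U U0 p V emQ wint w0 sets_borel_cube)
    also have "\<dots> \<le> ennreal (\<epsilon> ^ CARD('d)) *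
        (\<integral>\<^sup>+\<xi>\<in>ball 0 r. (\<integral>\<^sup>+x. ennreal (\<bar>U (x + \<epsilon> *\<^sub>R \<xi>) - U x\<bar> powr p) \<partial>lborel) \<partial>lborel)"
      by (rule sum_adjacent_cubes_le_energy[OF U s \<epsilon> r that])
    also have "(\<integral>\<^sup>+\<xi>\<in>ball 0 r. (\<integral>\<^sup>+x. ennreal (\<bar>U (x + \<epsilon> *\<^sub>R \<xi>) - U x\<bar> powr p) \<partial>lborel) \<partial>lborel)
        = (\<integral>\<^sup>+\<xi>. ennreal (\<epsilon> powr p) * ((\<integral>\<^sup>+x. ennreal (\<bar>(U (x + \<epsilon> *\<^sub>R \<xi>) - U x) / \<epsilon>\<bar> powr p) \<partial>lborel) * indicator (ball 0 r) \<xi>) \<partial>lborel)"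
    proof (rule nn_integral_cong)
      fix \<xi> :: "real ^ 'd"
      have "(\<integral>\<^sup>+x. ennreal (\<bar>U (x + \<epsilon> *\<^sub>R \<xi>) - U x\<bar> powr p) \<partial>lborel)
          = (\<integral>\<^sup>+x. ennreal (\<epsilon> powr p) * ennreal (\<bar>(U (x + \<epsilon> *\<^sub>R \<xi>) - U x) / \<epsilon>\<bar> powr p) \<partial>lborel)"
        using \<epsilon> by (intro nn_integral_cong) (simp add: powr_divide flip: ennreal_mult)
      also have "\<dots> = ennreal (\<epsilon> powr p) * (\<integral>\<^sup>+x. ennreal (\<bar>(U (x + \<epsilon> *\<^sub>R \<xi>) - U x) / \<epsilon>\<bar> powr p) \<partial>lborel)"
        by (intro nn_integral_cmult) measurable
      finally show "(\<integral>\<^sup>+x. ennreal (\<bar>U (x + \<epsilon> *\<^sub>R \<xi>) - U x\<bar> powr p) \<partial>lborel) * indicator (ball 0 r) \<xi>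
        = ennreal (\<epsilon> powr p) * ((\<integral>\<^sup>+x. ennreal (\<bar>(U (x + \<epsilon> *\<^sub>R \<xi>) - U x) / \<epsilon>\<bar> powr p) \<partial>lborel) * indicator (ball 0 r) \<xi>)"
        by (simp add: mult.assoc)
    qed
    also have "\<dots> = ennreal (\<epsilon> powr p) * ?G"
    proof (rule nn_integral_cmult)
      have [measurable]: "ball 0 r \<in> sets (borel :: (real ^ 'd) measure)" by simp
      show "(\<lambda>\<xi>. (\<integral>\<^sup>+x. ennreal (\<bar>(U (x + \<epsilon> *\<^sub>R \<xi>) - U x) / \<epsilon>\<bar> powr p) \<partial>lborel) * indicator (ball 0 r) \<xi>)
        \<in> borel_measurable lborel"
        by measurable
    qed
    also have "ennreal (\<epsilon> ^ CARD('d)) * (ennreal (\<epsilon> powr p) * ?G) = ennreal (\<epsilon> ^ CARD('d) * (\<epsilon> powr p * g))"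
      unfolding g(1) using g(2) \<epsilon> by (simp add: ennreal_mult)
    finally have "ennreal (\<Sum>k\<in>F. V\<^sup>2 * \<bar>w (k(j := k j + 1)) - w k\<bar> powr p)
        \<le> ennreal (\<epsilon> ^ CARD('d) * (\<epsilon> powr p * g))" .
    then have "(\<Sum>k\<in>F. V\<^sup>2 * \<bar>w (k(j := k j + 1)) - w k\<bar> powr p) \<le> \<epsilon> ^ CARD('d) * (\<epsilon> powr p * g)"
      using g(2) \<epsilon> by (subst (asm) ennreal_le_iff) auto
    then show ?thesis using V by (simp only: E_def sum_distrib_left[symmetric]) (simp add: field_simps)
  qed
  note sob = discrete_sobolev[OF p q \<gamma> w0 summ E]
  define S where "S = (\<Sum>\<^sub>\<infinity>k. w k powr q)"
  have S: "0 \<le> S" unfolding S_def by (intro infsum_nonneg) simp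
  have "(\<integral>\<^sup>+x. ennreal (w (vec_nth (cube_index s x)) powr q) \<partial>lborel) = ennreal (V * S)"
    using sob(1) V S nn_integral_piecewise_constant[OF s, of "\<lambda>k. ennreal (w k powr q)"]
    by (simp add: nn_integral_count_space_eq_infsum V_def S_def ennreal_mult)
  then have "ennreal_powr (\<integral>\<^sup>+x. ennreal (w (vec_nth (cube_index s x)) powr q) \<partial>lborel) (p / q)
      = ennreal ((V * S) powr (p / q))"
    using V S by (simp add: ennreal_powr_def)
  also have "\<dots> \<le> ennreal (V powr (p / q) * (2 * \<gamma> * (4 * \<gamma>) powr (p - 1) * E))"
    using sob(2) V S unfolding S_def[symmetric] by (intro ennreal_leI) (simp add: powr_mult)
  also have "V powr (p / q) * (2 * \<gamma> * (4 * \<gamma>) powr (p - 1) * E) = ?C * g"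
  proof -
    \<comment> \<open>With \<open>d = CARD('d)\<close>, the factor \<open>V powr (p / q)\<close> is
      \<open>s\<close> to the power \<open>d - p\<close>, and \<open>E\<close> contains
      \<open>s\<close> to the power \<open>- 2 * d\<close>. Together they give \<open>s\<close> to
      the power \<open>- (d + p)\<close>, which cancels the factor \<open>\<epsilon>\<close> to the
      power \<open>d + p\<close> in \<open>E\<close>.\<close>
    have "p / q = (real CARD('d) - p) / real CARD('d)" using p by (simp add: q)
    then have "V powr (p / q) = s powr (real CARD('d) - p)"
      using s p unfolding V_def by (simp add: powr_powr flip: powr_realpow)
    also have "\<dots> = V / s powr p" using s by (simp add: powr_diff powr_realpow V_def)
    finally have "V powr (p / q) * E = \<epsilon> ^ CARD('d) * (\<epsilon> powr p * g) / (V * s powr p)"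
      using V by (simp add: E_def power2_eq_square)
    also have "\<dots> = g / (\<rho> powr p * \<rho> ^ CARD('d))"
      using \<rho> \<epsilon> by (simp add: V_def s_def power_mult_distrib powr_mult)
    finally have VE: "V powr (p / q) * E = g / (\<rho> powr p * \<rho> ^ CARD('d))" .
    have "V powr (p / q) * (2 * \<gamma> * (4 * \<gamma>) powr (p - 1) * E)
        = 2 * \<gamma> * (4 * \<gamma>) powr (p - 1) * (V powr (p / q) * E)"
      by (simp only: mult_ac)
    then show ?thesis unfolding VE by simp
  qed
  also have "ennreal (?C * g) = ennreal ?C * ?G"
    unfolding g(1) using g(2) by (rule ennreal_mult'')
  finally show ?thesis .
qed

section \<open>Reduction from vectors to scalars\<close>

text \<open>A duality argument: pairing the vector of integrals with itself, moving it under the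
  integral and using the Cauchy--Schwarz inequality bounds \<open>R * R\<close> by \<open>R\<close>
  times the integral of the norm; then \<open>R\<close> is cancelled.\<close>

lemma L2_set_integral_le:
  fixes v :: "'a \<Rightarrow> 'i \<Rightarrow> real"
  assumes int: "\<And>i. i \<in> I \<Longrightarrow> set_integrable M A (\<lambda>x. v x i)"
    and intN: "set_integrable M A (\<lambda>x. L2_set (v x) I)"
  shows "L2_set (\<lambda>i. LINT x:A|M. v x i) I \<le> (LINT x:A|M. L2_set (v x) I)"
proof -
  define a where "a i = (LINT x:A|M. v x i)" for i
  define R where "R = L2_set a I"
  have "R * R = (\<Sum>i\<in>I. a i * a i)"
    by (simp add: R_def L2_set_def sum_nonneg power2_eq_square)
  also have "\<dots> = (\<Sum>i\<in>I. LINT x:A|M. a i * v x i)"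
    by (simp add: a_def)
  also have "\<dots> = (LINT x:A|M. \<Sum>i\<in>I. a i * v x i)"
    using int unfolding set_lebesgue_integral_def set_integrable_def
    by (subst Bochner_Integration.integral_sum[symmetric]) (auto simp: sum_distrib_left mult.left_commute)
  also have "\<dots> \<le> (LINT x:A|M. R * L2_set (v x) I)"
    unfolding set_lebesgue_integral_def
  proof (rule integral_mono)
    show "integrable M (\<lambda>x. indicator A x *\<^sub>R (\<Sum>i\<in>I. a i * v x i))"
      using int unfolding set_integrable_def
      by (auto simp: sum_distrib_left mult.left_commute intro!: Bochner_Integration.integrable_sum)
    show "integrable M (\<lambda>x. indicator A x *\<^sub>R (R * L2_set (v x) I))"
      using intN unfolding set_integrable_def by (simp add: mult.left_commute)
    show "indicator A x *\<^sub>R (\<Sum>i\<in>I. a i * v x i) \<le> indicator A x *\<^sub>R (R * L2_set (v x) I)" for x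
    proof -
      have "(\<Sum>i\<in>I. a i * v x i) \<le> (\<Sum>i\<in>I. \<bar>a i\<bar> * \<bar>v x i\<bar>)"
        by (intro sum_mono) (simp flip: abs_mult)
      also have "\<dots> \<le> R * L2_set (v x) I" unfolding R_def by (rule L2_set_mult_ineq)
      finally show ?thesis by (intro scaleR_left_mono) auto
    qed
  qed
  also have "\<dots> = R * (LINT x:A|M. L2_set (v x) I)" by simp
  finally have "R * R \<le> R * (LINT x:A|M. L2_set (v x) I)" .
  moreover have "0 \<le> R" by (simp add: R_def)
  moreover have "0 \<le> (LINT x:A|M. L2_set (v x) I)"
    unfolding set_lebesgue_integral_def by (intro Bochner_Integration.integral_nonneg) simp
  ultimately have "R \<le> (LINT x:A|M. L2_set (v x) I)"
    by (cases "R = 0") auto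
  then show ?thesis by (simp only: R_def a_def[abs_def])
qed

lemma abs_L2_set_diff_le: "\<bar>L2_set f I - L2_set g I\<bar> \<le> L2_set (\<lambda>i. f i - g i) I"
proof -
  have "L2_set f I \<le> L2_set (\<lambda>i. f i - g i) I + L2_set g I" for f g
    using L2_set_triangle_ineq[of "\<lambda>i. f i - g i" g I] by simp
  from this[of f g] this[of g f] show ?thesis
    by (simp add: L2_set_def power2_commute abs_le_iff)
qed

text \<open>Pointwise this is the reverse triangle inequality. As \<open>U\<close> equals the norm
  of \<open>u\<close> only almost everywhere, the comparison is made for each fixed
  \<open>\<xi>\<close>.\<close>

lemma scalar_energy_le:
  fixes u :: "real ^ 'd \<Rightarrow> nat \<Rightarrow> real"
  assumes ae: "AE x in lborel. L2_set (u x) {..<m} = U x" and \<epsilon>: "0 < \<epsilon>" and p: "1 \<le> p"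
  shows "(\<integral>\<^sup>+\<xi>\<in>ball 0 r. (\<integral>\<^sup>+x. ennreal (\<bar>(U (x + \<epsilon> *\<^sub>R \<xi>) - U x) / \<epsilon>\<bar> powr p) \<partial>lborel) \<partial>lborel)
    \<le> G_energy r p \<epsilon> m u"
  unfolding G_energy_def nn_integral_completion
proof (rule nn_integral_mono, rule mult_right_mono)
  fix \<xi> :: "real ^ 'd"
  \<comment> \<open>Translation invariance carries the almost everywhere equality to the shifted
    argument.\<close>
  have "AE x in distr lborel borel ((+) (\<epsilon> *\<^sub>R \<xi>)). L2_set (u x) {..<m} = U x"
    using ae by (simp only: lborel_distr_plus)
  then have "AE x in lborel. L2_set (u (\<epsilon> *\<^sub>R \<xi> + x)) {..<m} = U (\<epsilon> *\<^sub>R \<xi> + x)"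
    by (rule AE_distrD[rotated]) simp
  then have "AE x in lborel. ennreal (\<bar>(U (x + \<epsilon> *\<^sub>R \<xi>) - U x) / \<epsilon>\<bar> powr p)
      \<le> ennreal (L2_set (\<lambda>i. (u (x + \<epsilon> *\<^sub>R \<xi>) i - u x i) / \<epsilon>) {..<m} powr p)"
    using ae
  proof eventually_elim
    case (elim x)
    have "\<bar>(U (x + \<epsilon> *\<^sub>R \<xi>) - U x) / \<epsilon>\<bar> = 1 / \<epsilon> * \<bar>L2_set (u (x + \<epsilon> *\<^sub>R \<xi>)) {..<m} - L2_set (u x) {..<m}\<bar>"
      using elim \<epsilon> by (simp add: add.commute)
    also have "\<dots> \<le> 1 / \<epsilon> * L2_set (\<lambda>i. u (x + \<epsilon> *\<^sub>R \<xi>) i - u x i) {..<m}"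
      using \<epsilon> by (intro mult_left_mono abs_L2_set_diff_le) auto
    also have "\<dots> = L2_set (\<lambda>i. (u (x + \<epsilon> *\<^sub>R \<xi>) i - u x i) / \<epsilon>) {..<m}"
      using \<epsilon> by (subst L2_set_right_distrib) auto
    finally show ?case
      using p by (intro ennreal_leI powr_mono2) auto
  qed
  then show "(\<integral>\<^sup>+x. ennreal (\<bar>(U (x + \<epsilon> *\<^sub>R \<xi>) - U x) / \<epsilon>\<bar> powr p) \<partial>lborel)
      \<le> (\<integral>\<^sup>+x. ennreal (L2_set (\<lambda>i. (u (x + \<epsilon> *\<^sub>R \<xi>) i - u x i) / \<epsilon>) {..<m} powr p) \<partial>lborel)"
    by (rule nn_integral_mono_AE)
qed simp

lemma ennreal_powr_mono:
  assumes "x \<le> y" "0 \<le> a"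
  shows "ennreal_powr x a \<le> ennreal_powr y a"
proof (cases "y = \<infinity>")
  case False
  then have "x \<noteq> \<infinity>" "enn2real x \<le> enn2real y"
    using assms by (auto intro: enn2real_mono simp: less_top top_unique)
  then show ?thesis using False assms by (auto simp: ennreal_powr_def intro!: ennreal_leI powr_mono2)
qed (simp add: ennreal_powr_def)

text \<open>The norm of a mean is at most the mean of the norms. Membership in \<open>L^p\<close>
  makes the norm, and with it every coordinate, integrable on the cube, so that the means are
  genuine integrals and not the default 0.\<close>

lemma L2_set_T_avg_le:
  fixes u :: "real ^ 'd \<Rightarrow> nat \<Rightarrow> real"
  assumes u: "in_Lp p m u" and p: "1 \<le> p" and r: "0 < r" and \<epsilon>: "0 < \<epsilon>"
    and U[measurable]: "U \<in> borel_measurable borel" and ae: "AE x in lborel. L2_set (u x) {..<m} = U x"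
  defines "s \<equiv> r_tilde TYPE('d) r * \<epsilon>"
  shows "L2_set (T_avg r \<epsilon> u x) {..<m} \<le> (LINT y:cube s (cube_index s x)|lborel. U y) / s ^ CARD('d)"
proof -
  have s: "0 < s" using r \<epsilon> by (simp add: s_def r_tilde_def)
  let ?Q = "cube s (cube_index s x)"
  let ?N = "\<lambda>y. L2_set (u y) {..<m}"
  have u_meas[measurable]: "(\<lambda>y. u y i) \<in> borel_measurable lebesgue" if "i < m" for i
    using u that by (auto simp: in_Lp_def)
  have N[measurable]: "?N \<in> borel_measurable lebesgue"
    unfolding L2_set_def by measurable
  have Q[measurable]: "?Q \<in> sets lebesgue"
    using sets_borel_cube by auto
  have [measurable]: "U \<in> borel_measurable lebesgue"
    using U by (intro measurable_completion) simp
  have fin: "(\<integral>\<^sup>+y\<in>?Q. ennreal (?N y powr p) \<partial>lebesgue) < \<infinity>"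
    by (rule le_less_trans[of _ "\<integral>\<^sup>+y. ennreal (?N y powr p) \<partial>lebesgue"])
      (use u in \<open>auto simp: in_Lp_def intro!: nn_integral_mono split: split_indicator\<close>)
  have V: "emeasure lebesgue ?Q = ennreal (s ^ CARD('d))"
    using emeasure_cube[OF s, of "cube_index s x"] by simp
  have intN: "set_integrable lebesgue ?Q ?N"
    by (rule jensen_powr_nn_integral(1)[OF Q V _ p N _ fin]) (use s in auto)
  have int: "set_integrable lebesgue ?Q (\<lambda>y. u y i)" if i: "i \<in> {..<m}" for i
  proof (rule set_integrable_bound[OF intN])
    show "set_borel_measurable lebesgue ?Q (\<lambda>y. u y i)"
      using i Q by (auto simp: set_borel_measurable_def intro!: borel_measurable_times)
    show "AE y in lebesgue. y \<in> ?Q \<longrightarrow> norm (u y i) \<le> norm (?N y)"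
      using member_le_L2_set[of "{..<m}" i "\<lambda>i. \<bar>u y i\<bar>" for y] i
      by (intro AE_I2 impI) (auto simp: L2_set_def intro: order_trans[OF _ abs_ge_self])
  qed
  have T: "T_avg r \<epsilon> u x = (\<lambda>i. 1 / s ^ CARD('d) * (LINT y:?Q|lebesgue. u y i))"
    by (rule ext) (simp add: T_avg_def s_def Let_def)
  have "L2_set (T_avg r \<epsilon> u x) {..<m} = 1 / s ^ CARD('d) * L2_set (\<lambda>i. LINT y:?Q|lebesgue. u y i) {..<m}"
    using s T by (subst L2_set_right_distrib) auto
  also have "\<dots> \<le> 1 / s ^ CARD('d) * (LINT y:?Q|lebesgue. ?N y)"
    using s by (intro mult_left_mono L2_set_integral_le int intN) auto
  also have "(LINT y:?Q|lebesgue. ?N y) = (LINT y:?Q|lebesgue. U y)"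
    unfolding set_lebesgue_integral_def
    by (rule integral_cong_AE) (use AE_completion[OF ae] in \<open>auto elim: eventually_mono\<close>)
  also have "\<dots> = (LINT y:?Q|lborel. U y)"
    unfolding set_lebesgue_integral_def by (rule integral_completion) measurable
  finally show ?thesis by simp
qed

section \<open>The inequality for vector-valued functions\<close>

theorem theorem5p1:
  fixes p r pstar :: real
  assumes "1 \<le> p" and "p < real CARD('d::finite)" and "r > 0"
    and "pstar = p * real CARD('d) / (real CARD('d) - p)"
  shows "\<exists>C::real. C > 0 \<and>
    (\<forall>m\<ge>(1::nat). \<forall>\<epsilon>>0. \<forall>u :: real ^ 'd \<Rightarrow> nat \<Rightarrow> real. in_Lp p m u \<longrightarrow>
       ennreal_powr (\<integral>\<^sup>+x. ennreal (L2_set (T_avg r \<epsilon> u x) {..<m} powr pstar) \<partial>lebesgue) (p / pstar)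
         \<le> ennreal C * G_energy r p \<epsilon> m u)"
proof -
  define \<rho> where "\<rho> = r_tilde TYPE('d) r"
  have \<rho>: "0 < \<rho>" "\<rho> * sqrt (real CARD('d) + 3) = r"
    using assms(3) by (simp_all add: \<rho>_def r_tilde_def)
  define \<gamma> where "\<gamma> = p * (real CARD('d) - 1) / (real CARD('d) - p)"
  have \<gamma>: "0 < \<gamma>" using assms by (simp add: \<gamma>_def)
  have q: "0 < pstar" using assms by simp
  \<comment> \<open>\<open>C\<close> is fixed before \<open>m\<close>, \<open>\<epsilon>\<close> and
    \<open>u\<close>; it depends only on \<open>p\<close>, the dimension and, through
    \<open>\<rho>\<close>, on \<open>r\<close>.\<close>
  define C where "C = 2 * \<gamma> * (4 * \<gamma>) powr (p - 1) / (\<rho> powr p * \<rho> ^ CARD('d))"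
  have "0 < C" using \<rho> \<gamma> by (simp add: C_def)
  moreover have "ennreal_powr (\<integral>\<^sup>+x. ennreal (L2_set (T_avg r \<epsilon> u x) {..<m} powr pstar) \<partial>lebesgue) (p / pstar)
      \<le> ennreal C * G_energy r p \<epsilon> m u"
    if \<epsilon>: "0 < \<epsilon>" and u: "in_Lp p m u" for m \<epsilon> and u :: "real ^ 'd \<Rightarrow> nat \<Rightarrow> real"
  proof -
    let ?N = "\<lambda>y. L2_set (u y) {..<m}"
    have u_meas[measurable]: "(\<lambda>y. u y i) \<in> borel_measurable lebesgue" if "i < m" for i
      using u that by (auto simp: in_Lp_def)
    have "?N \<in> borel_measurable lebesgue"
      unfolding L2_set_def by measurable
    \<comment> \<open>A Borel version makes the difference quotient jointly measurable, as Tonelli requires.\<close>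
    then obtain U' where U': "U' \<in> borel_measurable lborel" "AE x in lborel. ?N x = U' x"
      using completion_ex_borel_measurable_real by blast
    \<comment> \<open>The modulus makes the Borel version nonnegative everywhere while it still
      equals the norm almost everywhere.\<close>
    define U where "U x = \<bar>U' x\<bar>" for x
    have U[measurable]: "U \<in> borel_measurable borel" and U0: "0 \<le> U x" for x
      using U'(1) by (auto simp: U_def[abs_def])
    have ae: "AE x in lborel. ?N x = U x"
      using U'(2)
    proof eventually_elim
      case (elim x)
      have "0 \<le> ?N x" by simp
      then show ?case using elim by (simp add: U_def)
    qed
    have "(\<integral>\<^sup>+x. ennreal (U x powr p) \<partial>lborel) = (\<integral>\<^sup>+x. ennreal (?N x powr p) \<partial>lborel)"
      using ae by (intro nn_integral_cong_AE) (auto elim: eventually_mono)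
    then have Lp: "(\<integral>\<^sup>+x. ennreal (U x powr p) \<partial>lborel) < \<infinity>"
      using u by (simp add: in_Lp_def nn_integral_completion)
    define s where "s = \<rho> * \<epsilon>"
    define w where "w k = (LINT x:cube s (vec_lambda k)|lborel. U x) / s ^ CARD('d)" for k
    have "L2_set (T_avg r \<epsilon> u x) {..<m} \<le> w (vec_nth (cube_index s x))" for x
      using L2_set_T_avg_le[OF u assms(1,3) \<epsilon> U ae, of x] by (simp add: w_def s_def \<rho>_def)
    then have "(\<integral>\<^sup>+x. ennreal (L2_set (T_avg r \<epsilon> u x) {..<m} powr pstar) \<partial>lborel)
        \<le> (\<integral>\<^sup>+x. ennreal (w (vec_nth (cube_index s x)) powr pstar) \<partial>lborel)"
      using q by (intro nn_integral_mono ennreal_leI powr_mono2) auto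
    then have "ennreal_powr (\<integral>\<^sup>+x. ennreal (L2_set (T_avg r \<epsilon> u x) {..<m} powr pstar) \<partial>lborel) (p / pstar)
        \<le> ennreal_powr (\<integral>\<^sup>+x. ennreal (w (vec_nth (cube_index s x)) powr pstar) \<partial>lborel) (p / pstar)"
      using q assms(1) by (intro ennreal_powr_mono) auto
    also have "\<dots> \<le> ennreal C *
        (\<integral>\<^sup>+\<xi>\<in>ball 0 r. (\<integral>\<^sup>+x. ennreal (\<bar>(U (x + \<epsilon> *\<^sub>R \<xi>) - U x) / \<epsilon>\<bar> powr p) \<partial>lborel) \<partial>lborel)"
      unfolding C_def w_def s_def
      by (rule sobolev_piecewise_means[OF U U0 Lp assms(1,2,4) \<gamma>_def \<rho> \<epsilon>])
    also have "\<dots> \<le> ennreal C * G_energy r p \<epsilon> m u"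
      by (intro mult_left_mono scalar_energy_le ae \<epsilon> assms(1)) simp
    finally show ?thesis by (simp only: nn_integral_completion)
  qed
  ultimately show ?thesis by blast
qed

end
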